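(* For $n\ge1$ and $g\ge0$ with $m:=n+1-2g\ge1$, the number $\xi_{n,g}$ of rooted one-face maps with $n$ edges and genus $g$ satisfies $$\xi_{n,g}=(2n-1)!!\sum_{k\ge0}\frac{(-1)^k{m+k\brack m}}{(m+k)!}\binom{n}{m+k-1}2^{m+k-1}.$$ In particular, $\xi_{n,0}=\frac{1}{n+1}\binom{2n}{n}$.
   Context: $\xi_{n,g}$ equals $\mu_{2n,m}([2^n])$ with $m=n+1-2g$: the number of pairs $(\sigma,\pi)$ of permutations of $[2n]$ with $\sigma\pi=(1\,2\,\cdots\,2n)$, $\sigma$ a fixed-point-free involution (cycle type $[2^n]$), and $\pi$ having exactly $n+1-2g$ cycles. ${a\brack b}$ is the unsigned Stirling number of the first kind (zero if $b>a$); $\binom{n}{k}=0$ for $k>n$. *)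

theory Defs
  imports "HOL-Combinatorics.Combinatorics" Complex_Main
begin

fun dfact :: "nat \<Rightarrow> nat" where
  "dfact 0 = 1"
| "dfact (Suc 0) = 1"
| "dfact (Suc (Suc k)) = Suc (Suc k) * dfact k"

definition long_cycle :: "nat \<Rightarrow> nat \<Rightarrow> nat" where
  "long_cycle N i = (if i \<in> {1..N} then (if i = N then 1 else i + 1) else i)"

definition num_cycles :: "('a \<Rightarrow> 'a) \<Rightarrow> 'a set \<Rightarrow> nat" where
  "num_cycles p S = card ((\<lambda>x. orbit p x) ` S)"

definition xi :: "nat \<Rightarrow> nat \<Rightarrow> nat" where
  "xi n g = card {(\<sigma>, \<pi>). \<sigma> permutes {1..2*n} \<and> \<pi> permutes {1..2*n}
      \<and> \<sigma> \<circ> \<pi> = long_cycle (2*n)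
      \<and> (\<forall>x\<in>{1..2*n}. \<sigma> (\<sigma> x) = x \<and> \<sigma> x \<noteq> x)
      \<and> num_cycles \<pi> {1..2*n} = n + 1 - 2*g}"

end

(* A pair (sigma, pi) is weighted by q^(cycles of pi), i.e. pi is coloured with q colours constant
   on its cycles. By conjugation one may replace the long cycle by an arbitrary full cycle. The
   indicator that g is a full cycle is the sum, over the g-invariant sets I avoiding a fixed point e,
   of (-1)^(cycles of g on I) = (-1)^|I| sign(g|I); this is a combinatorial form of
   det(1 - g) on the standard representation. After inserting it for g = sigma o pi, two sign-reversing
   involutions (pi -> pi o (a b) with a, b in I of equal colour, and conjugation of sigma by (a b)
   with a, b in I - pi(I)) leave only the pairs in which pi fixes all but at most one point of I.
   These are counted explicitly, the resulting alternating sum is evaluated by generating functions,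
   and the coefficients of q^m are compared via Stirling numbers. *)

theory Submission
  imports Defs "HOL-Computational_Algebra.Formal_Power_Series"
begin

subsection \<open>Signs and the indicator of full cycles\<close>

text \<open>The equation \<open>\<sigma> \<circ> \<pi> = long_cycle (2*n)\<close> ties the two
  permutations together rigidly. Allowing all (2n-1)! full cycles leaves only a condition on the
  cycle type of the product, which the signed sum turns into invariance of a set I; after the
  cancellations the matching and the coloured permutation can be counted independently of each
  other. The point e cannot be dropped: every cycle contributes -1 to the weight of an invariant
  set, so the sum over all invariant sets would be (1 - 1)^(number of cycles) = 0, whereas freezing
  the cycle of e leaves (1 - 1)^(number of other cycles). Colours do double duty. They turn the
  weight q^(cycles) into a set on which involutions act, and once they are injective on I, a point
  of I that is moved by \<pi> has to leave I. A matching exists only on a set of even size. Hence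
  sets I of even size meet the permutations that fix I pointwise, and sets of odd size meet those
  that move exactly one point of I. This is why the evaluation pairs the sizes 2a and 2a +
  1.\<close>

lemma sign_on_Un:
  assumes "bij_betw g A A" "bij_betw g B B" "A \<inter> B = {}" "finite A" "finite B"
  shows "sign_on (A \<union> B) g = sign_on A g * sign_on B g"
proof -
  have "restrict_id g (A \<union> B) = restrict_id g A \<circ> restrict_id g B"
    using assms(2,3) by (auto simp: restrict_id_def fun_eq_iff bij_betw_def)
  moreover have "permutation (restrict_id g A)" "permutation (restrict_id g B)"
    using assms permutes_imp_permutation permutes_restrict_id by blast+
  ultimately show ?thesis
    by (simp add: sign_on_def sign_compose)
qed

text \<open>A cycle of length l is a product of l - 1 transpositions. The prefactor absorbs the
  dependence on l, so that every cycle, even one of length 1, weighs -1.\<close>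

lemma sign_cycle_of_list:
  "distinct cs \<Longrightarrow> cs \<noteq> [] \<Longrightarrow> (-1) ^ length cs * sign (cycle_of_list cs) = -1"
proof (induction cs rule: cycle_of_list.induct)
  case (1 i j cs)
  then show ?case
    by (simp add: sign_compose permutation_of_cycle permutation_swap_id sign_swap_id del: comp_apply)
qed auto

lemma sign_on_orbit:
  assumes "permutation g"
  shows "(-1) ^ card (orbit g x) * sign_on (orbit g x) g = -1"
proof -
  have orb: "set (support g x) = orbit g x"
    unfolding support_set[OF assms] orbit_altdef_permutation[OF assms] by auto
  have "restrict_id g (orbit g x) = cycle_of_list (support g x)"
    using cycle_restrict[OF assms, of _ x] id_outside_supp[of _ "support g x"] unfolding orb
    by (simp add: restrict_id_def fun_eq_iff)
  moreover have "card (orbit g x) = length (support g x)"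
    unfolding orb[symmetric] by (rule distinct_card[OF cycle_of_permutation[OF assms]])
  moreover have "support g x \<noteq> []"
    using least_power_of_permutation(2)[OF assms, of x] by simp
  ultimately show ?thesis
    using sign_cycle_of_list[OF cycle_of_permutation[OF assms], of x] unfolding sign_on_def
    by simp
qed

lemma bij_betw_permutes_subset:
  assumes "g permutes S" "finite I" "g ` I = I"
  shows "bij_betw g I I"
  using assms by (simp add: bij_betw_def permutes_inj_on)

text \<open>Reindexing by \<open>t\<close> shows that the sum equals its own negative; at a fixed
  point of \<open>t\<close> the summand is 0, since there \<open>F x = - F x\<close>.\<close>

lemma sum_sign_reversing:
  fixes F :: "'c \<Rightarrow> int"
  assumes "\<And>x. x \<in> D \<Longrightarrow> t x \<in> D" "\<And>x. x \<in> D \<Longrightarrow> t (t x) = x"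
    and "\<And>x. x \<in> D \<Longrightarrow> F (t x) = - F x"
  shows "sum F D = 0"
proof -
  have "bij_betw t D D" by (rule bij_betw_byWitness[of _ t]) (use assms in auto)
  then have "sum F D = (\<Sum>x\<in>D. F (t x))" by (rule sum.reindex_bij_betw[symmetric])
  also have "\<dots> = - sum F D" using assms(3) by (simp add: sum_negf)
  finally show ?thesis by simp
qed

text \<open>If \<open>g\<close> is not a single cycle, toggling an orbit that misses \<open>e\<close> is a sign-reversing
  involution on the invariant sets.\<close>

lemma cyclic_indicator:
  assumes S: "finite S" and g: "g permutes S" and e: "e \<in> S"
  shows "(\<Sum>I | I \<subseteq> S - {e} \<and> g ` I = I. (-1) ^ card I * sign_on I g) =
         (if orbit g e = S then 1 else 0)"
proof (cases "orbit g e = S")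
  case True
  have "I = {}" if I: "I \<subseteq> S - {e}" "g ` I = I" for I
  proof (rule ccontr)
    assume "I \<noteq> {}"
    then obtain x where x: "x \<in> I" by auto
    have "orbit g x = S"
      using orbit_cyclic_eq3[of g S x] cyclic_on_orbit[OF g S, of e] True I x by auto
    moreover have "y \<in> I" if "y \<in> orbit g x" for y
      using that by induct (use x I in auto)
    ultimately show False using I e by auto
  qed
  then have "{I. I \<subseteq> S - {e} \<and> g ` I = I} = {{}}" by auto
  moreover have "sign_on {} g = 1"
    by (metis empty_iff sign_on_cong sign_on_id)
  ultimately show ?thesis using True by simp
next
  case False
  have perm: "permutation g" using S g by (auto simp: permutation_permutes)
  have "orbit g e \<subseteq> S" using permutes_orbit_subset[OF g e] .
  then obtain x where x: "x \<in> S" "x \<notin> orbit g e" using False by auto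
  define C where "C = orbit g x"
  have Ocyc: "cyclic_on g C" unfolding C_def by (rule cyclic_on_orbit[OF g S])
  have OS: "C \<subseteq> S - {e}"
    using x permutes_orbit_subset[OF g x(1)] permutation_self_in_orbit[OF perm] unfolding C_def
    by (metis Diff_empty orbit_swap subset_Diff_insert)
  have finO: "finite C" using OS S finite_subset by blast
  have gO: "g ` C = C"
  proof (rule card_subset_eq[OF finO])
    show "g ` C \<subseteq> C" using cyclic_on_inI[OF Ocyc] by auto
    show "card (g ` C) = card C" using g by (simp add: card_image permutes_inj_on)
  qed
  \<comment> \<open>C is a single cycle, so an invariant set either contains it or misses it; this
    makes toggling C an involution on the invariant sets.\<close>
  have Oall: "C \<subseteq> I" if "g ` I = I" "y \<in> C" "y \<in> I" for I y
  proof
    fix z assume "z \<in> C"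
    then have "z \<in> orbit g y" using Ocyc that(2) by (simp add: orbit_cyclic_eq3)
    then show "z \<in> I" by induct (use that in auto)
  qed
  define F where "F = {I. I \<subseteq> S - {e} \<and> g ` I = I}"
  define w where "w I = (-1) ^ card I * sign_on I g" for I
  define t where "t I = (if C \<subseteq> I then I - C else I \<union> C)" for I
  have xO: "x \<in> C" using permutation_self_in_orbit[OF perm] by (simp add: C_def)
  have finI: "finite I" if "I \<in> F" for I using that S unfolding F_def
    by (metis (lifting) CollectD finite_Diff finite_subset)
  have gdiff: "g ` (I - C) = I - C" "g ` (I \<union> C) = I \<union> C" if "g ` I = I" for I
    using that gO image_set_diff[OF permutes_inj[OF g], of I C] by auto
  have disj: "I \<inter> C = {}" if "I \<in> F" "\<not> C \<subseteq> I" for I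
    using Oall[of I] that unfolding F_def by blast
  have tF: "t I \<in> F" if "I \<in> F" for I
    using that gdiff OS unfolding F_def t_def by auto
  have tt: "t (t I) = I" if "I \<in> F" for I
    using that disj[OF that] xO unfolding t_def by auto
  have wU: "w (I \<union> C) = - w I" if "I \<in> F" "I \<inter> C = {}" for I
  proof -
    have "sign_on (I \<union> C) g = sign_on I g * sign_on C g"
      by (rule sign_on_Un) (use that finI[OF that(1)] finO gO in
          \<open>auto simp: F_def intro!: bij_betw_permutes_subset[OF g]\<close>)
    moreover have "card (I \<union> C) = card I + card C"
      using that finI[OF that(1)] finO by (simp add: card_Un_disjoint)
    ultimately have "w (I \<union> C) = w I * ((-1) ^ card C * sign_on C g)"
      unfolding w_def by (simp only: power_add mult_ac)
    then show ?thesis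
      using sign_on_orbit[OF perm, of x] by (simp add: C_def)
  qed
  have wt: "w (t I) = - w I" if "I \<in> F" for I
  proof (cases "C \<subseteq> I")
    case True
    have "I - C \<in> F" using tF[OF that] True by (simp add: t_def)
    moreover have "(I - C) \<inter> C = {}" by auto
    moreover have "I - C \<union> C = I" using True by auto
    ultimately have "w I = - w (I - C)" using wU[of "I - C"] by simp
    then show ?thesis using True by (simp add: t_def)
  next
    case False
    with wU[OF that disj[OF that False]] show ?thesis by (simp add: t_def)
  qed
  have "sum w F = 0" by (rule sum_sign_reversing[of F t]) (use tF tt wt in auto)
  then show ?thesis using False unfolding F_def w_def by simp
qed

subsection \<open>Perfect matchings\<close>

definition matchings :: "'a set \<Rightarrow> ('a \<Rightarrow> 'a) set" where
  "matchings S = {\<sigma>. \<sigma> permutes S \<and> (\<forall>x\<in>S. \<sigma> (\<sigma> x) = x \<and> \<sigma> x \<noteq> x)}"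

lemma finite_matchings: "finite S \<Longrightarrow> finite (matchings S)"
  by (rule finite_subset[OF _ finite_permutations[of S]]) (auto simp: matchings_def)

lemma matchings_empty [simp]: "matchings {} = {id}"
  by (auto simp: matchings_def)

lemma matchings_invariant_Diff:
  assumes "\<sigma> \<in> matchings S" "K \<subseteq> S" "\<sigma> ` K = K"
  shows "\<sigma> ` (S - K) = S - K"
proof -
  have "\<sigma> permutes S" using assms by (simp add: matchings_def)
  then have "\<sigma> ` (S - K) = \<sigma> ` S - \<sigma> ` K"
    by (meson Diff_subset assms(2) image_set_diff permutes_inj)
  then show ?thesis using assms(3) permutes_image[OF \<open>\<sigma> permutes S\<close>] by simp
qed

lemma restrict_id_matchings:
  assumes "\<sigma> \<in> matchings S" "K \<subseteq> S" "\<sigma> ` K = K"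
  shows "restrict_id \<sigma> K \<in> matchings K"
proof -
  have p: "\<sigma> permutes S" using assms by (simp add: matchings_def)
  have "restrict_id \<sigma> K permutes K"
    by (rule permutes_restrict_id) (use assms p in \<open>auto simp: bij_betw_def permutes_inj_on\<close>)
  then show ?thesis
    using assms unfolding matchings_def restrict_id_def by auto
qed

text \<open>The pairs inside an invariant K and those in its complement do not interact. The inverse
  map is composition: both factors are the identity outside their carriers, so their supports are
  disjoint.\<close>

lemma bij_betw_matchings_split:
  assumes "K \<subseteq> S"
  shows "bij_betw (\<lambda>\<sigma>. (restrict_id \<sigma> K, restrict_id \<sigma> (S - K)))
           {\<sigma> \<in> matchings S. \<sigma> ` K = K} (matchings K \<times> matchings (S - K))"
proof (rule bij_betw_byWitness[of _ "\<lambda>(a, b). a \<circ> b"])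
  have "restrict_id \<sigma> K \<circ> restrict_id \<sigma> (S - K) = \<sigma>" if "\<sigma> \<in> matchings S" "\<sigma> ` K = K" for \<sigma>
  proof
    fix x
    show "(restrict_id \<sigma> K \<circ> restrict_id \<sigma> (S - K)) x = \<sigma> x"
    proof (cases "x \<in> S")
      case False
      then show ?thesis using that assms by (auto simp: restrict_id_def matchings_def permutes_not_in)
    next
      case True
      then show ?thesis using matchings_invariant_Diff[OF that(1) assms that(2)]
        by (auto simp: restrict_id_def)
    qed
  qed
  then show "\<forall>\<sigma>\<in>{\<sigma> \<in> matchings S. \<sigma> ` K = K}.
      (case (restrict_id \<sigma> K, restrict_id \<sigma> (S - K)) of (a, b) \<Rightarrow> a \<circ> b) = \<sigma>"
    by simp
  have *: "restrict_id (a \<circ> b) K = a \<and> restrict_id (a \<circ> b) (S - K) = b \<and>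
      a \<circ> b \<in> matchings S \<and> (a \<circ> b) ` K = K"
    if "a \<in> matchings K" "b \<in> matchings (S - K)" for a b
  proof -
    have a: "a permutes K" and b: "b permutes S - K" using that by (auto simp: matchings_def)
    have "a permutes S" "b permutes S"
      using a b permutes_subset assms by blast+
    then have ab: "a \<circ> b permutes S" by (rule permutes_compose[rotated])
    have ap: "a x = x" if "x \<notin> K" for x using a that by (simp add: permutes_not_in)
    have bp: "b x = x" if "x \<notin> S - K" for x by (rule permutes_not_in[OF b that])
    have bS: "b x \<in> S - K" if "x \<in> S - K" for x using b that by (simp only: permutes_in_image)
    have aK: "a x \<in> K" if "x \<in> K" for x using a that by (simp only: permutes_in_image)
    have 1: "(a \<circ> b) x = a x" if "x \<in> K" for x using that bp by simp
    have 2: "(a \<circ> b) x = b x" if "x \<in> S - K" for x using that bS ap by auto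
    have "(a \<circ> b) ((a \<circ> b) x) = x \<and> (a \<circ> b) x \<noteq> x" if x: "x \<in> S" for x
    proof (cases "x \<in> K")
      case True
      then show ?thesis using \<open>a \<in> matchings K\<close> 1 aK unfolding matchings_def by simp
    next
      case False
      then have "x \<in> S - K" using x by simp
      then show ?thesis using \<open>b \<in> matchings (S - K)\<close> 2 bS[of x] ap[of x] unfolding matchings_def by simp
    qed
    then have "a \<circ> b \<in> matchings S" using ab unfolding matchings_def by simp
    moreover have "(a \<circ> b) ` K = K"
      using 1 permutes_image[OF a] by (simp cong: image_cong_simp)
    moreover have "restrict_id (a \<circ> b) K = a"
      using 1 ap by (auto simp: restrict_id_def fun_eq_iff)
    moreover have "restrict_id (a \<circ> b) (S - K) = b"
      using 2 bp by (auto simp: restrict_id_def fun_eq_iff)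
    ultimately show ?thesis by blast
  qed
  then show "\<forall>ab\<in>matchings K \<times> matchings (S - K).
      (restrict_id (case ab of (a, b) \<Rightarrow> a \<circ> b) K, restrict_id (case ab of (a, b) \<Rightarrow> a \<circ> b) (S - K)) = ab"
    by auto
  show "(\<lambda>(a, b). a \<circ> b) ` (matchings K \<times> matchings (S - K)) \<subseteq> {\<sigma> \<in> matchings S. \<sigma> ` K = K}"
    using * by fastforce
  show "(\<lambda>\<sigma>. (restrict_id \<sigma> K, restrict_id \<sigma> (S - K))) ` {\<sigma> \<in> matchings S. \<sigma> ` K = K}
      \<subseteq> matchings K \<times> matchings (S - K)"
    using restrict_id_matchings[OF _ assms] restrict_id_matchings[of _ S "S - K"]
      matchings_invariant_Diff[OF _ assms] by auto
qed

text \<open>The predicate \<open>P\<close> is kept free so that a prescribed pair in the complement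
  of K can be imposed; with \<open>P\<close> constantly true this is the plain product rule.\<close>

lemma card_matchings_split:
  assumes "K \<subseteq> S"
  shows "card {\<sigma> \<in> matchings S. \<sigma> ` K = K \<and> P (restrict_id \<sigma> (S - K))} =
         card (matchings K) * card {\<tau> \<in> matchings (S - K). P \<tau>}"
proof -
  let ?h = "\<lambda>\<sigma>. (restrict_id \<sigma> K, restrict_id \<sigma> (S - K))"
  note bij = bij_betw_matchings_split[OF assms]
  let ?D = "{\<sigma> \<in> matchings S. \<sigma> ` K = K \<and> P (restrict_id \<sigma> (S - K))}"
  have "?h ` ?D = {p \<in> ?h ` {\<sigma> \<in> matchings S. \<sigma> ` K = K}. P (snd p)}"
    by (auto simp only: image_iff mem_Collect_eq snd_conv bex_simps)
  also have "\<dots> = matchings K \<times> {\<tau> \<in> matchings (S - K). P \<tau>}"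
    unfolding bij_betw_imp_surj_on[OF bij] by auto
  finally have "bij_betw ?h ?D (matchings K \<times> {\<tau> \<in> matchings (S - K). P \<tau>})"
    by (intro bij_betw_subset[OF bij]) auto
  then show ?thesis
    by (simp add: bij_betw_same_card card_cartesian_product)
qed

lemma matchings_pair:
  assumes "i \<noteq> j"
  shows "matchings {i, j} = {transpose i j}"
proof -
  have "\<sigma> = transpose i j" if "\<sigma> \<in> matchings {i, j}" for \<sigma>
  proof -
    have p: "\<sigma> permutes {i, j}" "\<sigma> i \<noteq> i" "\<sigma> j \<noteq> j" using that by (auto simp: matchings_def)
    then have "\<sigma> i = j" "\<sigma> j = i"
      using permutes_in_image[OF p(1), of i] permutes_in_image[OF p(1), of j] by auto
    then show ?thesis using permutes_not_in[OF p(1)]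
      by (auto simp: fun_eq_iff transpose_def)
  qed
  moreover have "transpose i j \<in> matchings {i, j}"
    using assms by (auto simp: matchings_def permutes_swap_id)
  ultimately show ?thesis by blast
qed

lemma matchings_image_pair:
  assumes "\<sigma> \<in> matchings S" "i \<in> S" "j \<in> S" "i \<noteq> j"
  shows "\<sigma> ` {i, j} = {i, j} \<longleftrightarrow> \<sigma> j = i"
proof
  assume "\<sigma> ` {i, j} = {i, j}"
  then have "\<sigma> j \<in> {i, j}" by auto
  then show "\<sigma> j = i" using assms by (auto simp: matchings_def)
next
  assume "\<sigma> j = i"
  moreover from this have "\<sigma> i = j" using assms by (auto simp: matchings_def)
  ultimately show "\<sigma> ` {i, j} = {i, j}" by auto
qed

lemma card_matchings_through:
  assumes "i \<in> S" "j \<in> S" "i \<noteq> j"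
  shows "card {\<sigma> \<in> matchings S. \<sigma> j = i} = card (matchings (S - {i, j}))"
proof -
  have "{\<sigma> \<in> matchings S. \<sigma> j = i} = {\<sigma> \<in> matchings S. \<sigma> ` {i, j} = {i, j} \<and> True}"
    using matchings_image_pair[OF _ assms] by blast
  then show ?thesis
    using card_matchings_split[of "{i, j}" S "\<lambda>_. True"] assms
    by (simp add: matchings_pair)
qed

text \<open>Splitting off one pair {x, \<sigma> x} removes two points and a transposition of sign
  -1. As the sign depends on \<open>card S\<close> alone, a sum of signs over matchings reduces to a
  count.\<close>

lemma even_card_sign_matching:
  assumes "finite S" "\<sigma> \<in> matchings S"
  shows "even (card S) \<and> sign \<sigma> = (-1) ^ (card S div 2)"
  using assms
proof (induction S arbitrary: \<sigma> rule: finite_psubset_induct)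
  case (psubset S)
  show ?case
  proof (cases "S = {}")
    case True
    then show ?thesis using psubset.prems by simp
  next
    case False
    then obtain x where x: "x \<in> S" by auto
    define y where "y = \<sigma> x"
    have p: "\<sigma> permutes S" and y: "y \<in> S" "y \<noteq> x" "\<sigma> y = x"
      using psubset.prems x permutes_in_image unfolding y_def matchings_def by fastforce+
    let ?K = "{x, y}"
    have K: "?K \<subseteq> S" using x y by auto
    have inv: "\<sigma> ` ?K = ?K" using y y_def by auto
    let ?a = "restrict_id \<sigma> ?K" and ?b = "restrict_id \<sigma> (S - ?K)"
    have a: "?a = transpose x y" using y y_def by (auto simp: restrict_id_def fun_eq_iff transpose_def)
    have b: "?b \<in> matchings (S - ?K)"
      using restrict_id_matchings[OF psubset.prems _ matchings_invariant_Diff[OF psubset.prems K inv]]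
      by auto
    have IH: "even (card (S - ?K)) \<and> sign ?b = (-1) ^ (card (S - ?K) div 2)"
      by (rule psubset.IH[OF _ b]) (use x in auto)
    have c: "card S = Suc (Suc (card (S - ?K)))"
      using card_Diff_subset[of ?K S] card_mono[OF psubset.hyps(1) K] K y by simp
    have "sign \<sigma> = sign_on S \<sigma>" using p by (simp add: sign_on_permutes)
    also have "\<dots> = sign_on (?K \<union> (S - ?K)) \<sigma>" using K by (metis Diff_partition)
    also have "\<dots> = sign_on ?K \<sigma> * sign_on (S - ?K) \<sigma>"
      by (rule sign_on_Un)
        (use p inv matchings_invariant_Diff[OF psubset.prems K inv] psubset.hyps(1) in
          \<open>auto simp: bij_betw_def permutes_inj_on\<close>)
    also have "\<dots> = - ((-1) ^ (card (S - ?K) div 2))"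
      using IH y(2) unfolding sign_on_def a by (simp add: sign_swap_id)
    finally show ?thesis using c IH by simp
  qed
qed

lemma card_matchings:
  assumes "finite S" "card S = 2 * k"
  shows "card (matchings S) = dfact (2 * k - 1)"
  using assms
proof (induction k arbitrary: S)
  case 0
  then show ?case by simp
next
  case (Suc k)
  then obtain x where x: "x \<in> S" by fastforce
  have "matchings S = (\<Union>y\<in>S - {x}. {\<sigma> \<in> matchings S. \<sigma> x = y})"
    using x by (auto simp: matchings_def permutes_in_image)
  then have "card (matchings S) = (\<Sum>y\<in>S - {x}. card {\<sigma> \<in> matchings S. \<sigma> x = y})"
    using Suc.prems(1) finite_matchings[OF Suc.prems(1)]
      card_UN_disjoint[of "S - {x}" "\<lambda>y. {\<sigma> \<in> matchings S. \<sigma> x = y}"] by auto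
  also have "\<dots> = (\<Sum>y\<in>S - {x}. dfact (2 * k - 1))"
  proof (rule sum.cong[OF refl])
    fix y assume y: "y \<in> S - {x}"
    have "card (S - {y, x}) = 2 * k"
      using y x Suc.prems by (simp add: card_Diff_subset)
    then show "card {\<sigma> \<in> matchings S. \<sigma> x = y} = dfact (2 * k - 1)"
      using y x Suc card_matchings_through[of y S x] by auto
  qed
  also have "\<dots> = (2 * k + 1) * dfact (2 * k - 1)" using x Suc.prems by simp
  \<comment> \<open>For k = 0 truncated subtraction turns \<open>2 * k - 1\<close> into 0, and
    \<open>dfact 0 = 1\<close> realises the convention (-1)!! = 1.\<close>
  also have "\<dots> = dfact (2 * Suc k - 1)" by (cases k) auto
  finally show ?case .
qed

subsection \<open>Colourings\<close>

text \<open>R holds the points that may move, B those that carry a colour, I those whose colours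
  must be distinct. Keeping them apart allows a recursion in which R and B grow together while I
  stays fixed; the points of B - R are coloured fixed points.\<close>

definition coloured_perms :: "'a set \<Rightarrow> 'a set \<Rightarrow> 'b set \<Rightarrow> 'a set \<Rightarrow> (('a \<Rightarrow> 'a) \<times> ('a \<Rightarrow> 'b)) set" where
  "coloured_perms R B Q I =
     {(\<pi>, f). \<pi> permutes R \<and> f \<in> B \<rightarrow>\<^sub>E Q \<and> (\<forall>x. f (\<pi> x) = f x) \<and> inj_on f I}"

lemma finite_coloured_perms:
  assumes "finite R" "finite B" "finite Q"
  shows "finite (coloured_perms R B Q I)"
  by (rule finite_subset[of _ "{\<pi>. \<pi> permutes R} \<times> (B \<rightarrow>\<^sub>E Q)"])
    (use assms in \<open>auto simp: coloured_perms_def finite_permutations intro!: finite_PiE\<close>)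

text \<open>The new point a either forms a cycle of its own, with a free colour from Q, or is
  inserted just before some b in R and inherits its colour; hence the factor
  \<open>card Q + card R\<close>. As a lies outside I, injectivity on I is unaffected.\<close>

lemma card_coloured_perms_insert:
  fixes a :: 'a and Q :: "'b set"
  assumes fin: "finite R" "finite B" "finite Q" and a: "a \<notin> B" and sub: "R \<subseteq> B" "I \<subseteq> B"
  shows "card (coloured_perms (insert a R) (insert a B) Q I) =
         (card Q + card R) * card (coloured_perms R B Q I)"
proof -
  define h where "h = (\<lambda>((\<pi> :: 'a \<Rightarrow> 'a, f :: 'a \<Rightarrow> 'b), c).
    case c of Inl q \<Rightarrow> (\<pi>, f(a := q)) | Inr b \<Rightarrow> (transpose a b \<circ> \<pi>, f(a := f b)))"
  \<comment> \<open>The inverse cuts a out of its cycle: composing with the transposition fixes a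
    and sends its predecessor to the old image of a. The colour of a is reset to
    \<open>undefined\<close>, as extensionality on B demands.\<close>
  define k where "k = (\<lambda>(\<pi> :: 'a \<Rightarrow> 'a, f :: 'a \<Rightarrow> 'b).
    ((transpose a (\<pi> a) \<circ> \<pi>, f(a := undefined)), if \<pi> a = a then Inl (f a) else Inr (\<pi> a)))"
  have aR: "a \<notin> R" using a sub by auto
  have "bij_betw h (coloured_perms R B Q I \<times> (Q <+> R)) (coloured_perms (insert a R) (insert a B) Q I)"
  proof (rule bij_betw_byWitness[of _ k])
    have Inl: "k (h ((\<pi>, f), Inl q)) = ((\<pi>, f), Inl q) \<and>
        h ((\<pi>, f), Inl q) \<in> coloured_perms (insert a R) (insert a B) Q I"
      if "(\<pi>, f) \<in> coloured_perms R B Q I" "q \<in> Q" for \<pi> f q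
    proof -
      have p: "\<pi> permutes R" "f \<in> B \<rightarrow>\<^sub>E Q" "\<And>x. f (\<pi> x) = f x" "inj_on f I"
        using that by (auto simp: coloured_perms_def)
      have pa: "\<pi> a = a" using p(1) aR by (simp add: permutes_not_in)
      have "f a = undefined" using p(2) a by auto
      moreover have "\<pi> x = a \<longleftrightarrow> x = a" for x using pa permutes_inj[OF p(1)] by (metis injD)
      then have "(f(a := q)) (\<pi> x) = (f(a := q)) x" for x using p(3) by simp
      moreover have "\<pi> permutes insert a R" using p(1) permutes_subset by blast
      moreover have "f(a := q) \<in> insert a B \<rightarrow>\<^sub>E Q" using p(2) that(2) by (auto simp: PiE_iff extensional_def)
      moreover have "inj_on (f(a := q)) I"
        using p(4) a sub(2) by (auto simp: inj_on_def)
      ultimately show ?thesis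
        using pa unfolding h_def k_def coloured_perms_def by (simp add: fun_upd_idem)
    qed
    have Inr: "k (h ((\<pi>, f), Inr b)) = ((\<pi>, f), Inr b) \<and>
        h ((\<pi>, f), Inr b) \<in> coloured_perms (insert a R) (insert a B) Q I"
      if "(\<pi>, f) \<in> coloured_perms R B Q I" "b \<in> R" for \<pi> f b
    proof -
      have p: "\<pi> permutes R" "f \<in> B \<rightarrow>\<^sub>E Q" "\<And>x. f (\<pi> x) = f x" "inj_on f I"
        using that by (auto simp: coloured_perms_def)
      have pa: "\<pi> a = a" using p(1) aR by (simp add: permutes_not_in)
      have ba: "b \<noteq> a" using that aR by auto
      have fa: "f a = undefined" using p(2) a by auto
      have pa': "\<pi> x = a \<longleftrightarrow> x = a" for x using pa permutes_inj[OF p(1)] by (metis injD)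
      have "\<pi> permutes insert a R" using p(1) permutes_subset by blast
      then have tp: "transpose a b \<circ> \<pi> permutes insert a R"
        by (rule permutes_compose) (use that(2) in \<open>auto intro!: permutes_swap_id\<close>)
      have "f b \<in> Q" using p(2) that(2) sub(1) by auto
      then have fB: "f(a := f b) \<in> insert a B \<rightarrow>\<^sub>E Q" using p(2) by (auto simp: PiE_iff extensional_def)
      have inj: "inj_on (f(a := f b)) I"
        using p(4) a sub(2) by (auto simp: inj_on_def)
      have "(f(a := f b)) ((transpose a b \<circ> \<pi>) x) = (f(a := f b)) x" for x
      proof (cases "x = a")
        case True
        then show ?thesis using pa ba by simp
      next
        case False
        then show ?thesis using p(3)[of x] pa'[of x] by (cases "\<pi> x = b") (auto simp: transpose_def)
      qed
      then have "h ((\<pi>, f), Inr b) \<in> coloured_perms (insert a R) (insert a B) Q I"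
        using tp fB inj by (simp add: h_def coloured_perms_def)
      moreover have "transpose a b \<circ> (transpose a b \<circ> \<pi>) = \<pi>"
        by (simp add: fun_eq_iff)
      then have "k (h ((\<pi>, f), Inr b)) = ((\<pi>, f), Inr b)"
        using pa ba fa unfolding h_def k_def by (simp add: fun_upd_idem)
      ultimately show ?thesis by simp
    qed
    have K: "h (k (\<pi>, f)) = (\<pi>, f) \<and> k (\<pi>, f) \<in> coloured_perms R B Q I \<times> (Q <+> R)"
      if "(\<pi>, f) \<in> coloured_perms (insert a R) (insert a B) Q I" for \<pi> f
    proof -
      have p: "\<pi> permutes insert a R" "f \<in> insert a B \<rightarrow>\<^sub>E Q" "\<And>x. f (\<pi> x) = f x" "inj_on f I"
        using that by (auto simp: coloured_perms_def)
      let ?p = "transpose a (\<pi> a) \<circ> \<pi>" and ?f = "f(a := undefined)"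
      have 1: "?p permutes R" by (rule permutes_insert_lemma[OF p(1)])
      have 2: "?f \<in> B \<rightarrow>\<^sub>E Q" using p(2) a by (auto simp: PiE_iff extensional_def)
      have 3: "inj_on ?f I" using p(4) a sub(2) by (auto simp: inj_on_def)
      have inj: "\<pi> x = \<pi> y \<longleftrightarrow> x = y" for x y using permutes_inj[OF p(1)] by (metis injD)
      have 4: "?f (?p x) = ?f x" for x
      proof (cases "x = a")
        case True
        then show ?thesis by simp
      next
        case False
        then show ?thesis using p(3)[of x] p(3)[of a] inj[of x a]
          by (cases "\<pi> x = a") (auto simp: transpose_def)
      qed
      have "(if \<pi> a = a then Inl (f a) else Inr (\<pi> a)) \<in> Q <+> R"
        using p(2) permutes_in_image[OF p(1), of a] by auto
      then have "k (\<pi>, f) \<in> coloured_perms R B Q I \<times> (Q <+> R)"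
        using 1 2 3 4 by (simp add: k_def coloured_perms_def)
      moreover have "transpose a (\<pi> a) \<circ> (transpose a (\<pi> a) \<circ> \<pi>) = \<pi>"
        by (simp add: fun_eq_iff)
      then have "h (k (\<pi>, f)) = (\<pi>, f)"
        using p(3)[of a] by (auto simp: h_def k_def fun_eq_iff)
      ultimately show ?thesis by simp
    qed
    show "\<forall>x\<in>coloured_perms R B Q I \<times> (Q <+> R). k (h x) = x"
      using Inl Inr by auto
    show "h ` (coloured_perms R B Q I \<times> (Q <+> R)) \<subseteq> coloured_perms (insert a R) (insert a B) Q I"
      using Inl Inr by auto
    show "\<forall>x\<in>coloured_perms (insert a R) (insert a B) Q I. h (k x) = x"
      using K by auto
    show "k ` coloured_perms (insert a R) (insert a B) Q I \<subseteq> coloured_perms R B Q I \<times> (Q <+> R)"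
      using K by (intro image_subsetI) (metis surj_pair)
  qed
  then have "card (coloured_perms (insert a R) (insert a B) Q I) =
      card (coloured_perms R B Q I) * card (Q <+> R)"
    by (metis bij_betw_same_card card_cartesian_product)
  then show ?thesis using fin by (simp add: card_Plus mult.commute)
qed

text \<open>Every inserted point enlarges R by one, so the successive factors form a rising
  factorial starting at \<open>card Q + card R\<close>.\<close>

lemma card_coloured_perms_Un:
  assumes "finite C" "finite R" "finite B" "finite Q" "C \<inter> B = {}" "R \<subseteq> B" "I \<subseteq> B"
  shows "card (coloured_perms (R \<union> C) (B \<union> C) Q I) =
         pochhammer (card Q + card R) (card C) * card (coloured_perms R B Q I)"
  using assms
proof (induction C rule: finite_induct)
  case (insert a C)
  have "card (coloured_perms (insert a (R \<union> C)) (insert a (B \<union> C)) Q I) =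
      (card Q + card (R \<union> C)) * card (coloured_perms (R \<union> C) (B \<union> C) Q I)"
    by (rule card_coloured_perms_insert) (use insert in auto)
  moreover have "card (R \<union> C) = card R + card C"
    by (rule card_Un_disjoint) (use insert in auto)
  moreover have "card (insert a C) = Suc (card C)" using insert by simp
  moreover have "card (coloured_perms (R \<union> C) (B \<union> C) Q I) =
         pochhammer (card Q + card R) (card C) * card (coloured_perms R B Q I)"
    using insert by auto
  ultimately show ?case by (simp only: Un_insert_right pochhammer_Suc of_nat_id add_ac mult_ac)
qed simp

text \<open>The hypothesis \<open>triv\<close> says that R has at most one point; the empty set and
  {i} are the two starting points of the recursion. What remains are the injective colourings of B,
  and \<open>gchoose\<close> gives the correct value 0 when there are too few colours.\<close>

lemma card_coloured_perms_base:
  assumes "finite B" "finite Q" and triv: "\<And>\<pi>. \<pi> permutes R \<Longrightarrow> \<pi> = id"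
  shows "real (card (coloured_perms R B Q B)) = fact (card B) * (real (card Q) gchoose card B)"
proof -
  have "coloured_perms R B Q B = {id} \<times> {f \<in> B \<rightarrow>\<^sub>E Q. inj_on f B}"
    using triv by (auto simp: coloured_perms_def permutes_id)
  then have c: "card (coloured_perms R B Q B) = prod ((-) (card Q)) {0..<card B}"
    using card_inj_on_subset_funcset[OF assms(1,2) subset_refl] by (simp add: card_cartesian_product)
  show ?thesis
  proof (cases "card B \<le> card Q")
    case True
    then have "real (prod ((-) (card Q)) {0..<card B}) = (\<Prod>i<card B. real (card Q) - real i)"
      by (auto simp: lessThan_atLeast0 of_nat_diff intro!: prod.cong)
    then show ?thesis unfolding c by (simp add: gbinomial_prod_rev atLeast0LessThan)
  next
    case False
    then have "prod ((-) (card Q)) {0..<card B} = 0"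
      by (intro prod_zero) (auto intro!: bexI[of _ "card Q"])
    moreover have "real (card Q) gchoose card B = 0"
      using False by (simp add: binomial_gbinomial[symmetric])
    ultimately show ?thesis unfolding c by simp
  qed
qed

subsection \<open>Conjugating full cycles\<close>

lemma orbit_eq_iff_permutes:
  assumes "\<pi> permutes S" "finite S"
  shows "y \<in> orbit \<pi> x \<longleftrightarrow> orbit \<pi> y = orbit \<pi> x"
  using cyclic_on_orbit[OF assms, of x] cyclic_on_orbit[OF assms, of y]
    orbit_cyclic_eq3[of \<pi> "orbit \<pi> x" y] permutation_self_in_orbit[of \<pi> y] assms
  by (auto simp: permutation_permutes)

lemma card_invariant_colourings:
  assumes S: "finite S" and p: "\<pi> permutes S"
  shows "card {f \<in> S \<rightarrow>\<^sub>E Q. \<forall>x. f (\<pi> x) = f x} = card Q ^ num_cycles \<pi> S"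
proof -
  let ?C = "(\<lambda>x. orbit \<pi> x) ` S"
  define F where "F = {f \<in> S \<rightarrow>\<^sub>E Q. \<forall>x. f (\<pi> x) = f x}"
  define h where "h = (\<lambda>g x. if x \<in> S then g (orbit \<pi> x) else undefined :: 'b)"
  define k where "k = (\<lambda>f c. if c \<in> ?C then f (SOME x. x \<in> c) else undefined :: 'b)"
  have perm: "permutation \<pi>" using p S by (auto simp: permutation_permutes)
  have self: "x \<in> orbit \<pi> x" for x by (rule permutation_self_in_orbit[OF perm])
  have some: "(SOME x. x \<in> c) \<in> c \<and> (SOME x. x \<in> c) \<in> S" if "c \<in> ?C" for c
  proof -
    have "\<exists>x. x \<in> c" using that self by auto
    then have "(SOME x. x \<in> c) \<in> c" by (rule someI_ex)
    moreover have "c \<subseteq> S" using that permutes_orbit_subset[OF p] by auto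
    ultimately show ?thesis by auto
  qed
  have const: "f y = f x" if "f \<in> F" "y \<in> orbit \<pi> x" for f x y
    using that(2) by induct (use that(1) in \<open>auto simp: F_def\<close>)
  have "bij_betw h (?C \<rightarrow>\<^sub>E Q) F"
  proof (rule bij_betw_byWitness[of _ k])
    show "\<forall>g\<in>?C \<rightarrow>\<^sub>E Q. k (h g) = g"
    proof (intro ballI ext)
      fix g c assume g: "g \<in> ?C \<rightarrow>\<^sub>E Q"
      show "k (h g) c = g c"
      proof (cases "c \<in> ?C")
        case True
        then obtain x where x: "c = orbit \<pi> x" by auto
        have "orbit \<pi> (SOME x. x \<in> c) = c"
          using some[OF True] orbit_eq_iff_permutes[OF p S] unfolding x by blast
        then show ?thesis using True some[OF True] by (simp add: k_def h_def)
      next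
        case False
        then show ?thesis using g by (auto simp: k_def PiE_iff extensional_def)
      qed
    qed
    show "\<forall>f\<in>F. h (k f) = f"
    proof (intro ballI ext)
      fix f x assume f: "f \<in> F"
      show "h (k f) x = f x"
      proof (cases "x \<in> S")
        case True
        then show ?thesis using some[of "orbit \<pi> x"] const[OF f] by (auto simp: h_def k_def)
      next
        case False
        then show ?thesis using f by (auto simp: h_def F_def PiE_iff extensional_def)
      qed
    qed
    show "h ` (?C \<rightarrow>\<^sub>E Q) \<subseteq> F"
      using p by (auto simp: F_def h_def permutes_in_image permutation_orbit_step[OF perm])
    show "k ` F \<subseteq> ?C \<rightarrow>\<^sub>E Q"
    proof (intro image_subsetI PiE_I)
      fix f c assume "f \<in> F" "c \<in> ?C"
      then show "k f c \<in> Q" using some[of c] by (auto simp: k_def F_def)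
    next
      fix f c assume "c \<notin> ?C"
      then show "k f c = undefined" by (simp add: k_def)
    qed
  qed
  then have "card F = card (?C \<rightarrow>\<^sub>E Q)" by (metis bij_betw_same_card)
  then show ?thesis using S by (simp add: card_funcsetE num_cycles_def F_def)
qed

lemma num_cycles_conj:
  assumes "\<pi> permutes S" "finite S" "h permutes S"
  shows "num_cycles (h \<circ> \<pi> \<circ> inv h) S = num_cycles \<pi> S"
proof -
  have perm: "permutation \<pi>" using assms by (auto simp: permutation_permutes)
  have orb: "orbit (h \<circ> \<pi> \<circ> inv h) (h x) = h ` orbit \<pi> x" for x
    by (rule orbit_inverse[symmetric])
      (use permutation_self_in_orbit[OF perm] permutes_inverses[OF assms(3)] in auto)
  have "(\<lambda>x. orbit (h \<circ> \<pi> \<circ> inv h) x) ` S = (\<lambda>x. orbit (h \<circ> \<pi> \<circ> inv h) x) ` h ` S"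
    using permutes_image[OF assms(3)] by simp
  also have "\<dots> = (`) h ` (\<lambda>x. orbit \<pi> x) ` S"
    by (simp only: image_image orb)
  finally show ?thesis unfolding num_cycles_def
    by (simp add: card_image inj_on_def inj_image_eq_iff[OF permutes_inj[OF assms(3)]])
qed

lemma matchings_conj:
  assumes "\<sigma> \<in> matchings S" "h permutes S"
  shows "h \<circ> \<sigma> \<circ> inv h \<in> matchings S"
proof -
  have "h \<circ> \<sigma> \<circ> inv h permutes S"
    using assms by (auto simp: matchings_def intro!: permutes_compose permutes_inv)
  moreover have "inv h x \<in> S" if "x \<in> S" for x
    using permutes_in_image[OF permutes_inv[OF assms(2)]] that by blast
  moreover have "h x = y \<longleftrightarrow> x = inv h y" for x y
    using permutes_inverses[OF assms(2)] by metis
  ultimately show ?thesis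
    using assms(1) permutes_inverses[OF assms(2)] by (auto simp: matchings_def)
qed

section \<open>Full cycles as conjugates of the long cycle\<close>

lemma long_cycle_permutes: "long_cycle N permutes {1..N}"
proof (rule bij_imp_permutes)
  show "long_cycle N x = x" if "x \<notin> {1..N}" for x using that by (auto simp: long_cycle_def)
  have inj: "inj_on (long_cycle N) {1..N}" by (auto simp: inj_on_def long_cycle_def)
  moreover have "long_cycle N ` {1..N} \<subseteq> {1..N}" by (auto simp: long_cycle_def)
  ultimately show "bij_betw (long_cycle N) {1..N} {1..N}"
    by (simp add: bij_betw_def endo_inj_surj)
qed

lemma long_cycle_funpow: "k < N \<Longrightarrow> (long_cycle N ^^ k) 1 = k + 1"
  by (induction k) (auto simp: long_cycle_def)

lemma long_cycle_funpow_pred: "x \<in> {1..N} \<Longrightarrow> (long_cycle N ^^ (x - 1)) 1 = x"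
  using long_cycle_funpow[of "x - 1" N] by (cases x) auto

lemma orbit_long_cycle:
  assumes "N \<ge> 1"
  shows "orbit (long_cycle N) 1 = {1..N}"
proof
  show "orbit (long_cycle N) 1 \<subseteq> {1..N}"
    using assms by (intro permutes_orbit_subset long_cycle_permutes) auto
  have perm: "permutation (long_cycle N)"
    using long_cycle_permutes[of N] by (auto simp: permutation_permutes)
  show "{1..N} \<subseteq> orbit (long_cycle N) 1"
  proof
    fix x assume "x \<in> {1..N}"
    then have "(long_cycle N ^^ (x - 1)) 1 = x" by (rule long_cycle_funpow_pred)
    then show "x \<in> orbit (long_cycle N) 1"
      unfolding orbit_altdef_permutation[OF perm] by (metis (mono_tags) mem_Collect_eq)
  qed
qed

lemma full_cycle_conj_long_cycle:
  assumes c: "c permutes {1..N}" and orb: "orbit c 1 = {1..N}"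
  obtains h where "h permutes {1..N}" "h 1 = 1" "c \<circ> h = h \<circ> long_cycle N"
proof -
  have perm: "permutation c" using c by (auto simp: permutation_permutes)
  have sup: "set (support c 1) = {1..N}"
    using orb unfolding support_set[OF perm] orbit_altdef_permutation[OF perm] by auto
  have lp: "least_power c 1 = N"
    using distinct_card[OF cycle_of_permutation[OF perm, of 1]] unfolding sup by simp
  have N: "N \<ge> 1" using permutation_self_in_orbit[OF perm, of 1] orb by auto
  \<comment> \<open>Labelling along the cycle: i goes to the (i-1)-st iterate of 1 under c. This
    fixes 1 and turns the successor modulo N into c.\<close>
  define h where "h i = (if i \<in> {1..N} then (c ^^ (i - 1)) 1 else i)" for i
  have img: "h ` {1..N} = {1..N}"
  proof -
    have "h ` {1..N} = (\<lambda>i. (c ^^ (i - 1)) 1) ` {1..N}" by (simp add: h_def)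
    also have "\<dots> = (\<lambda>i. (c ^^ (i - 1)) 1) ` Suc ` {0..<N}"
      by (simp only: image_Suc_atLeastLessThan atLeastLessThanSuc_atLeastAtMost One_nat_def)
    also have "\<dots> = set (support c 1)" unfolding lp by (simp add: image_image del: image_Suc_atLeastLessThan)
    finally show ?thesis using sup by simp
  qed
  then have "bij_betw h {1..N} {1..N}"
    by (simp add: bij_betw_def eq_card_imp_inj_on)
  then have "h permutes {1..N}"
    by (rule bij_imp_permutes) (auto simp: h_def)
  moreover have "h 1 = 1" using N by (simp add: h_def)
  moreover have "c (h i) = h (long_cycle N i)" for i
  proof -
    consider "i \<notin> {1..N}" | "i = N" | "i \<in> {1..<N}" by fastforce
    then show ?thesis
    proof cases
      case 1
      then show ?thesis using permutes_not_in[OF c 1] by (auto simp: h_def long_cycle_def)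
    next
      case 2
      have "c (h N) = (c ^^ Suc (N - 1)) 1" using N by (cases N) (auto simp: h_def)
      also have "\<dots> = 1" using least_power_of_permutation(1)[OF perm, of 1] N lp by simp
      finally show ?thesis using 2 N by (simp add: h_def long_cycle_def)
    next
      case 3
      then have "c (h i) = (c ^^ Suc (i - 1)) 1" by (cases i) (auto simp: h_def)
      then show ?thesis using 3 by (cases i) (auto simp: h_def long_cycle_def)
    qed
  qed
  then have "c \<circ> h = h \<circ> long_cycle N" by (simp add: fun_eq_iff)
  ultimately show ?thesis by (rule that)
qed

text \<open>Every full cycle arises from \<open>long_cycle N\<close> by conjugation with exactly one
  h satisfying h 1 = 1: the normalisation removes the rotations commuting with the long cycle and
  leaves (N-1)! choices. Conjugation respects matchings and the number of cycles.\<close>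

lemma card_full_cycle_pairs:
  assumes N: "N \<ge> 1"
  shows "card {(\<sigma>, \<pi>). \<sigma> \<in> matchings {1..N} \<and> \<pi> permutes {1..N} \<and>
            orbit (\<sigma> \<circ> \<pi>) 1 = {1..N} \<and> num_cycles \<pi> {1..N} = m}
       = fact (N - 1) * card {(\<sigma>, \<pi>). \<sigma> \<in> matchings {1..N} \<and> \<pi> permutes {1..N} \<and>
            \<sigma> \<circ> \<pi> = long_cycle N \<and> num_cycles \<pi> {1..N} = m}" (is "card ?Y = _ * card ?X")
proof -
  let ?S = "{1..N}"
  define H where "H = {h. h permutes ?S \<and> h 1 = (1 :: nat)}"
  define c where "c h p = h \<circ> p \<circ> inv h" for h p :: "nat \<Rightarrow> nat"
  define F where "F = (\<lambda>(h, \<sigma>, \<pi>). (c h \<sigma>, c h \<pi>))"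
  have inv1: "inv h \<circ> h = id" and inv2: "h \<circ> inv h = id" if "h \<in> H" for h
    using that permutes_inv_o unfolding H_def by blast+
  have c_comp: "c h p \<circ> c h q = c h (p \<circ> q)" if "h \<in> H" for h p q
    using inv1[OF that] unfolding c_def by (metis comp_assoc comp_id)
  have c_inj: "p = q" if "h \<in> H" "c h p = c h q" for h p q
  proof -
    have "inv h \<circ> c h p \<circ> h = p" for p
      using inv1[OF that(1)] unfolding c_def by (metis comp_assoc comp_id id_comp)
    then show ?thesis using that(2) by metis
  qed
  have "bij_betw F (H \<times> ?X) ?Y"
  proof (rule bij_betw_imageI)
    show "inj_on F (H \<times> ?X)"
    proof (rule inj_onI, clarsimp simp: F_def)
      fix h \<sigma> \<pi> h' \<sigma>' \<pi>'
      assume h: "h \<in> H" "h' \<in> H" and eq: "\<sigma> \<circ> \<pi> = long_cycle N" "\<sigma>' \<circ> \<pi>' = long_cycle N"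
        and c: "c h \<sigma> = c h' \<sigma>'" "c h \<pi> = c h' \<pi>'"
      have cc: "c h (long_cycle N) = c h' (long_cycle N)"
        using c c_comp[OF h(1), of \<sigma> \<pi>] c_comp[OF h(2), of \<sigma>' \<pi>'] eq by metis
      \<comment> \<open>Iterating the conjugated cycle from 1 reads off the values of h in order, so
        the product of the two conjugated permutations determines h.\<close>
      have pow: "(c h (long_cycle N) ^^ k) 1 = h ((long_cycle N ^^ k) 1)" if "h \<in> H" for h k
      proof (induction k)
        case 0
        then show ?case using that by (simp add: H_def)
      next
        case (Suc k)
        have "inv h (h y) = y" for y using inv1[OF that] by (simp add: fun_eq_iff)
        then show ?case using Suc by (simp add: c_def)
      qed
      have "h x = h' x" for x
      proof (cases "x \<in> ?S")
        case True
        then have "(long_cycle N ^^ (x - 1)) 1 = x" by (rule long_cycle_funpow_pred)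
        then show ?thesis using pow[OF h(1), of "x - 1"] pow[OF h(2), of "x - 1"] cc by simp
      next
        case False
        then show ?thesis using h permutes_not_in unfolding H_def by (metis (lifting) mem_Collect_eq)
      qed
      then have "h = h'" by auto
      then show "h = h' \<and> \<sigma> = \<sigma>' \<and> \<pi> = \<pi>'" using c c_inj[OF h(1)] by simp
    qed
    show "F ` (H \<times> ?X) = ?Y"
    proof (intro equalityI subsetI)
      fix y assume "y \<in> F ` (H \<times> ?X)"
      then obtain h \<sigma> \<pi> where h: "h \<in> H" and y: "y = (c h \<sigma>, c h \<pi>)"
        and X: "\<sigma> \<in> matchings ?S" "\<pi> permutes ?S" "\<sigma> \<circ> \<pi> = long_cycle N" "num_cycles \<pi> ?S = m"
        by (auto simp: F_def)
      have hp: "h permutes ?S" "h 1 = 1" using h by (auto simp: H_def)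
      have "orbit (c h (long_cycle N)) (h 1) = h ` orbit (long_cycle N) 1"
        by (rule orbit_inverse[symmetric])
          (use orbit_long_cycle[OF N] N permutes_inverses[OF hp(1)] in \<open>auto simp: c_def\<close>)
      then have "orbit (c h \<sigma> \<circ> c h \<pi>) 1 = ?S"
        using c_comp[OF h] X(3) hp orbit_long_cycle[OF N] permutes_image[OF hp(1)] by simp
      moreover have "c h \<pi> permutes ?S"
        unfolding c_def using X(2) hp(1) by (intro permutes_compose permutes_inv)
      ultimately show "y \<in> ?Y"
        using X num_cycles_conj[OF X(2) _ hp(1)] matchings_conj[OF X(1) hp(1)] by (simp add: y c_def)
    next
      fix y assume "y \<in> ?Y"
      then obtain \<sigma> \<pi> where y: "y = (\<sigma>, \<pi>)" and Y: "\<sigma> \<in> matchings ?S" "\<pi> permutes ?S"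
        "orbit (\<sigma> \<circ> \<pi>) 1 = ?S" "num_cycles \<pi> ?S = m" by auto
      have "\<sigma> \<circ> \<pi> permutes ?S" using Y by (auto simp: matchings_def intro: permutes_compose)
      then obtain h where hp: "h permutes ?S" "h 1 = 1" "(\<sigma> \<circ> \<pi>) \<circ> h = h \<circ> long_cycle N"
        using full_cycle_conj_long_cycle[OF _ Y(3)] by blast
      have h: "h \<in> H" using hp by (simp add: H_def)
      let ?d = "\<lambda>p. inv h \<circ> p \<circ> h"
      have ih: "inv h permutes ?S" "inv (inv h) = h"
        using hp(1) permutes_inv permutes_inv_inv by blast+
      have cd: "c h (?d p) = p" for p
        using inv2[OF h] unfolding c_def by (metis comp_assoc comp_id id_comp)
      have "?d \<sigma> \<circ> ?d \<pi> = inv h \<circ> ((\<sigma> \<circ> \<pi>) \<circ> h)"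
        using inv2[OF h] by (metis comp_assoc comp_id)
      also have "\<dots> = long_cycle N"
        unfolding hp(3) using inv1[OF h] by (metis comp_assoc id_comp)
      finally have "(?d \<sigma>, ?d \<pi>) \<in> ?X"
        using matchings_conj[OF Y(1) ih(1)] num_cycles_conj[OF Y(2) _ ih(1)] Y(2,4) hp(1) ih
        by (auto intro!: permutes_compose)
      moreover have "y = F (h, ?d \<sigma>, ?d \<pi>)" by (simp add: F_def cd y)
      ultimately show "y \<in> F ` (H \<times> ?X)" using h by blast
    qed
  qed
  then have "card ?Y = card H * card ?X"
    using bij_betw_same_card[of F "H \<times> ?X" ?Y] by (simp only: card_cartesian_product)
  moreover have "H = {h. h permutes ?S - {1}}"
    unfolding H_def by (auto intro: permutes_subset permutes_superset simp: permutes_not_in)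
  then have "card H = fact (N - 1)"
    using N by (simp add: card_permutations)
  ultimately show ?thesis by simp
qed

subsection \<open>Cancellation in the signed sum\<close>

definition signed_count :: "'a set \<Rightarrow> 'a set \<Rightarrow> ('a \<Rightarrow> 'a) \<Rightarrow> int" where
  "signed_count S I \<pi> = (\<Sum>\<sigma> | \<sigma> \<in> matchings S \<and> \<sigma> ` \<pi> ` I = I. sign_on I (\<sigma> \<circ> \<pi>))"

lemma transpose_image_subset:
  "a \<in> I \<Longrightarrow> b \<in> I \<Longrightarrow> transpose a b ` I = I"
  by (auto simp: transpose_def image_iff split: if_splits)

lemma bij_betw_transpose: "a \<in> I \<Longrightarrow> b \<in> I \<Longrightarrow> bij_betw (transpose a b) I I"
  by (simp add: bij_betw_def transpose_image_subset)

lemma bij_betw_matching_comp: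
  assumes "\<sigma> \<in> matchings S" "\<pi> permutes S" "\<sigma> ` \<pi> ` I = I"
  shows "bij_betw (\<sigma> \<circ> \<pi>) I I"
proof -
  have "\<sigma> \<circ> \<pi> permutes S"
    using assms(1,2) by (auto simp: matchings_def intro: permutes_compose)
  from permutes_inj_on[OF this] assms(3) show ?thesis by (simp add: bij_betw_def image_comp)
qed

text \<open>The set \<pi>(I) does not change, so the same matchings contribute, while the
  permutation induced on I gains a transposition.\<close>

lemma signed_count_transpose:
  assumes "finite I" "\<pi> permutes S" "a \<in> I" "b \<in> I" "a \<noteq> b"
  shows "signed_count S I (\<pi> \<circ> transpose a b) = - signed_count S I \<pi>"
proof -
  have "sign_on I (\<sigma> \<circ> (\<pi> \<circ> transpose a b)) = - sign_on I (\<sigma> \<circ> \<pi>)"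
    if "\<sigma> \<in> matchings S" "\<sigma> ` \<pi> ` I = I" for \<sigma>
  proof -
    have "bij_betw (\<sigma> \<circ> \<pi>) I I"
      using that assms(2) by (intro bij_betw_matching_comp)
    then have "sign_on I ((\<sigma> \<circ> \<pi>) \<circ> transpose a b) = sign_on I (\<sigma> \<circ> \<pi>) * sign_on I (transpose a b)"
      using assms by (intro sign_on_compose bij_betw_transpose)
    then show ?thesis using assms by (simp add: sign_on_transpose comp_assoc)
  qed
  moreover have "(\<pi> \<circ> transpose a b) ` I = \<pi> ` I"
    using transpose_image_subset[OF assms(3,4)] by (metis image_comp)
  ultimately show ?thesis
    unfolding signed_count_def by (simp add: sum_negf[symmetric] cong: sum.cong_simp)
qed

text \<open>Since a and b are not images of points of I, the transposition t = (a b) fixes \<pi>(I)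
  pointwise. On I, conjugating \<sigma> by t therefore amounts to composing \<sigma> \<circ> \<pi>
  with t on the left, which keeps I invariant and flips the sign.\<close>

lemma signed_count_eq_0:
  assumes "finite S" "I \<subseteq> S" "\<pi> permutes S" and ab: "a \<in> I - \<pi> ` I" "b \<in> I - \<pi> ` I" "a \<noteq> b"
  shows "signed_count S I \<pi> = 0"
  unfolding signed_count_def
proof (rule sum_sign_reversing[of _ "\<lambda>\<sigma>. transpose a b \<circ> \<sigma> \<circ> transpose a b"])
  let ?t = "transpose a b"
  fix \<sigma> assume "\<sigma> \<in> {\<sigma>. \<sigma> \<in> matchings S \<and> \<sigma> ` \<pi> ` I = I}"
  then have s: "\<sigma> \<in> matchings S" "\<sigma> ` \<pi> ` I = I" by auto
  have "?t permutes S" using ab assms(2) by (auto intro!: permutes_swap_id)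
  then have m: "?t \<circ> \<sigma> \<circ> ?t \<in> matchings S"
    using matchings_conj[OF s(1), of ?t] by simp
  have fixed: "?t (\<pi> x) = \<pi> x" if "x \<in> I" for x
    using ab that by (auto simp: transpose_def)
  then have c: "(?t \<circ> \<sigma> \<circ> ?t \<circ> \<pi>) x = (?t \<circ> (\<sigma> \<circ> \<pi>)) x" if "x \<in> I" for x
    using that by simp
  have "(?t \<circ> \<sigma> \<circ> ?t) ` \<pi> ` I = (?t \<circ> \<sigma> \<circ> ?t \<circ> \<pi>) ` I" by (simp add: image_comp)
  also have "\<dots> = (?t \<circ> (\<sigma> \<circ> \<pi>)) ` I" using c by (rule image_cong[OF refl])
  also have "\<dots> = ?t ` \<sigma> ` \<pi> ` I" by (simp add: image_comp comp_assoc)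
  also have "\<dots> = I" using s(2) transpose_image_subset ab by simp
  finally show "?t \<circ> \<sigma> \<circ> ?t \<in> {\<sigma>. \<sigma> \<in> matchings S \<and> \<sigma> ` \<pi> ` I = I}" using m by simp
  show "?t \<circ> (?t \<circ> \<sigma> \<circ> ?t) \<circ> ?t = \<sigma>" by (simp add: fun_eq_iff)
  have "bij_betw (\<sigma> \<circ> \<pi>) I I"
    using s assms(3) by (intro bij_betw_matching_comp)
  then have "sign_on I (?t \<circ> (\<sigma> \<circ> \<pi>)) = sign_on I ?t * sign_on I (\<sigma> \<circ> \<pi>)"
    using ab assms(1,2) by (intro sign_on_compose bij_betw_transpose) (auto intro: finite_subset)
  moreover have "sign_on I (?t \<circ> \<sigma> \<circ> ?t \<circ> \<pi>) = sign_on I (?t \<circ> (\<sigma> \<circ> \<pi>))"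
    using c by (intro sign_on_cong) auto
  ultimately show "sign_on I (?t \<circ> \<sigma> \<circ> ?t \<circ> \<pi>) = - sign_on I (\<sigma> \<circ> \<pi>)"
    using ab by (simp add: sign_on_transpose)
qed

text \<open>The sum of the signs of all matchings of k points; also the value at 0 of the k-th
  (probabilists') Hermite polynomial. For k = 0 the truncated \<open>k - 1\<close> yields 1.\<close>

definition matching_sign :: "nat \<Rightarrow> int" where
  "matching_sign k = (if even k then (-1) ^ (k div 2) * int (dfact (k - 1)) else 0)"

lemma sum_sign_matchings:
  assumes "finite S" "K \<subseteq> S"
  shows "(\<Sum>\<sigma> | \<sigma> \<in> matchings S \<and> \<sigma> ` K = K \<and> P (restrict_id \<sigma> (S - K)). sign_on K \<sigma>)
       = matching_sign (card K) * int (card {\<tau> \<in> matchings (S - K). P \<tau>})"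
proof -
  let ?D = "{\<sigma> \<in> matchings S. \<sigma> ` K = K \<and> P (restrict_id \<sigma> (S - K))}"
  have finK: "finite K" using assms finite_subset by auto
  have s: "even (card K) \<and> sign_on K \<sigma> = (-1) ^ (card K div 2)" if "\<sigma> \<in> ?D" for \<sigma>
    using even_card_sign_matching[OF finK restrict_id_matchings[of \<sigma> S K]] that assms(2)
    by (simp add: sign_on_def)
  show ?thesis
  proof (cases "even (card K)")
    case True
    then obtain k where k: "card K = 2 * k" by auto
    have "sum (\<lambda>\<sigma>. sign_on K \<sigma>) ?D = (\<Sum>\<sigma>\<in>?D. (-1) ^ (card K div 2))"
      by (intro sum.cong refl) (use s in blast)
    also have "\<dots> = matching_sign (card K) * int (card {\<tau> \<in> matchings (S - K). P \<tau>})"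
      unfolding sum_constant card_matchings_split[OF assms(2)] card_matchings[OF finK k]
      using True by (simp add: matching_sign_def k)
    finally show ?thesis .
  next
    case False
    then have "?D = {}" using s by blast
    show ?thesis unfolding \<open>?D = {}\<close> using False by (simp add: matching_sign_def)
  qed
qed

lemma signed_count_fixing:
  assumes "finite S" "I \<subseteq> S" "\<And>x. x \<in> I \<Longrightarrow> \<pi> x = x"
  shows "signed_count S I \<pi> = matching_sign (card I) * int (card (matchings (S - I)))"
proof -
  have "\<pi> ` I = I" using assms(3) by simp
  moreover have "sign_on I (\<sigma> \<circ> \<pi>) = sign_on I \<sigma>" for \<sigma> using assms(3) by (intro sign_on_cong) auto
  ultimately show ?thesis
    unfolding signed_count_def using sum_sign_matchings[OF assms(1,2), of "\<lambda>_. True"] by simp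
qed

text \<open>Only i leaves I, so invariance of I under \<sigma> \<circ> \<pi> forces \<sigma> to pair
  \<pi> i with i and to preserve I - {i}. Then \<sigma> \<circ> \<pi> fixes i, and its sign on I is
  that of \<sigma> on I - {i}.\<close>

lemma signed_count_moving:
  assumes S: "finite S" "I \<subseteq> S" and p: "\<pi> permutes S" and i: "i \<in> I" "\<pi> i \<notin> I"
    and fxd: "\<And>x. x \<in> I - {i} \<Longrightarrow> \<pi> x = x"
  shows "signed_count S I \<pi> =
         matching_sign (card I - 1) * int (card (matchings (S - insert (\<pi> i) I)))"
proof -
  let ?K = "I - {i}" and ?j = "\<pi> i"
  have finI: "finite I" using S finite_subset by auto
  have j: "?j \<in> S" using p i S by (auto simp: permutes_in_image)
  have img: "\<pi> ` I = insert ?j ?K"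
  proof -
    have "\<pi> ` ?K = ?K" using fxd by simp
    then have "\<pi> ` insert i ?K = insert ?j ?K" by (simp only: image_insert)
    then show ?thesis using i by (simp add: insert_absorb)
  qed
  have iff: "\<sigma> ` \<pi> ` I = I \<longleftrightarrow> \<sigma> ` ?K = ?K \<and> restrict_id \<sigma> (S - ?K) ?j = i"
    if "\<sigma> \<in> matchings S" for \<sigma>
  proof -
    have r: "restrict_id \<sigma> (S - ?K) ?j = \<sigma> ?j" using j i by (simp add: restrict_id_def)
    have inv: "\<sigma> (\<sigma> x) = x" if "x \<in> S" for x using \<open>\<sigma> \<in> matchings S\<close> that by (simp add: matchings_def)
    have inj: "inj \<sigma>" using that permutes_inj by (auto simp: matchings_def)
    have "\<sigma> ` ?K = ?K \<and> \<sigma> ?j = i" if a: "\<sigma> ` \<pi> ` I = I"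
    proof -
      \<comment> \<open>Being an involution, \<sigma> exchanges I and \<pi>(I), hence preserves
        their intersection I - {i}.\<close>
      have "\<sigma> ` \<sigma> ` insert ?j ?K = insert ?j ?K"
        using inv j S by (force simp: image_iff)
      then have "\<sigma> ` I = insert ?j ?K" by (metis a img)
      then have "\<sigma> ` (I \<inter> insert ?j ?K) = insert ?j ?K \<inter> I"
        using a unfolding img image_Int[OF inj] by (simp only:)
      moreover have "I \<inter> insert ?j ?K = ?K" using i by auto
      ultimately have K: "\<sigma> ` ?K = ?K" by (simp add: Int_commute)
      have "\<sigma> ?j \<in> I" using a unfolding img by auto
      moreover have "\<sigma> ?j \<notin> ?K"
      proof
        assume "\<sigma> ?j \<in> ?K"
        then have "\<sigma> ?j \<in> \<sigma> ` ?K" using K by simp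
        then show False using i inj by (auto simp: inj_image_mem_iff)
      qed
      ultimately show ?thesis using K by auto
    qed
    moreover have "\<sigma> ` \<pi> ` I = I" if "\<sigma> ` ?K = ?K" "\<sigma> ?j = i"
      using that i unfolding img image_insert by auto
    ultimately show ?thesis unfolding r by blast
  qed
  have sgn: "sign_on I (\<sigma> \<circ> \<pi>) = sign_on ?K \<sigma>"
    if s: "\<sigma> \<in> matchings S" "\<sigma> ` ?K = ?K" "restrict_id \<sigma> (S - ?K) ?j = i" for \<sigma>
  proof -
    have "\<sigma> ?j = i" using s(3) j i by (simp add: restrict_id_def)
    then have "sign_on I (\<sigma> \<circ> \<pi>) = sign_on ?K (\<sigma> \<circ> \<pi>)"
      unfolding sign_on_def restrict_id_def by (intro arg_cong[of _ _ sign]) (auto simp: fun_eq_iff)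
    also have "\<dots> = sign_on ?K \<sigma>" using fxd by (intro sign_on_cong) auto
    finally show ?thesis .
  qed
  have "signed_count S I \<pi> =
     (\<Sum>\<sigma> | \<sigma> \<in> matchings S \<and> \<sigma> ` ?K = ?K \<and> restrict_id \<sigma> (S - ?K) ?j = i. sign_on ?K \<sigma>)"
    unfolding signed_count_def
  proof (rule sum.cong)
    show "{\<sigma>. \<sigma> \<in> matchings S \<and> \<sigma> ` \<pi> ` I = I} =
        {\<sigma>. \<sigma> \<in> matchings S \<and> \<sigma> ` ?K = ?K \<and> restrict_id \<sigma> (S - ?K) ?j = i}"
      by (intro Collect_cong conj_cong refl iff)
  qed (simp only: mem_Collect_eq sgn)
  also have "\<dots> = matching_sign (card ?K) * int (card {\<tau> \<in> matchings (S - ?K). \<tau> ?j = i})"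
    by (rule sum_sign_matchings) (use S in auto)
  also have "card {\<tau> \<in> matchings (S - ?K). \<tau> ?j = i} = card (matchings (S - ?K - {i, ?j}))"
    by (rule card_matchings_through) (use i j S in auto)
  also have "S - ?K - {i, ?j} = S - insert ?j I" using i by auto
  finally show ?thesis using i finI by simp
qed

text \<open>The permutations moving exactly the point i of I are counted as a difference: those
  fixing I - {i} minus those fixing i as well. For them 2n - |I| - 1 points remain to be matched
  once I and \<pi> i are removed, whence the argument \<open>2 * n - card I - 2\<close> of
  \<open>dfact\<close>.\<close>

lemma sum_signed_count_coloured_perms:
  fixes S :: "'a set" and Q :: "'b set"
  assumes S: "finite S" "card S = 2 * n" and Q: "finite Q" and I: "I \<subseteq> S" "I \<noteq> S"
  shows "(\<Sum>(\<pi>, f)\<in>coloured_perms S S Q {}. signed_count S I \<pi>) =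
      matching_sign (card I) * int (dfact (2 * n - card I - 1)) * int (card (coloured_perms (S - I) S Q I))
    + (\<Sum>i\<in>I. matching_sign (card I - 1) * int (dfact (2 * n - card I - 2)) *
        (int (card (coloured_perms (S - (I - {i})) S Q I)) - int (card (coloured_perms (S - I) S Q I))))"
proof -
  let ?C = "coloured_perms S S Q {}" and ?CI = "coloured_perms S S Q I"
  have finI: "finite I" using S(1) I finite_subset by auto
  have finC: "finite ?C" "finite ?CI" using S(1) Q by (auto intro: finite_coloured_perms)
  have sub: "?CI \<subseteq> ?C" by (auto simp: coloured_perms_def)
  define F where "F = (\<lambda>(\<pi>, f :: 'a \<Rightarrow> 'b). signed_count S I \<pi>)"
  have "sum F (?C - ?CI) = 0"
  proof -
    \<comment> \<open>The pair is chosen from f alone, which the move leaves unchanged; the second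
      application thus uses the same transposition and undoes the first.\<close>
    define ab where "ab f = (SOME (a, b). a \<in> I \<and> b \<in> I \<and> a \<noteq> b \<and> f a = f b)" for f :: "'a \<Rightarrow> 'b"
    define t where "t = (\<lambda>(\<pi> :: 'a \<Rightarrow> 'a, f). (\<pi> \<circ> transpose (fst (ab f)) (snd (ab f)), f))"
    have ab: "fst (ab f) \<in> I" "snd (ab f) \<in> I" "fst (ab f) \<noteq> snd (ab f)" "f (fst (ab f)) = f (snd (ab f))"
      if "(\<pi>, f) \<in> ?C - ?CI" for \<pi> f
    proof -
      have "\<exists>p. (\<lambda>(a, b). a \<in> I \<and> b \<in> I \<and> a \<noteq> b \<and> f a = f b) p"
        using that by (auto simp: coloured_perms_def inj_on_def)
      then have "(\<lambda>(a, b). a \<in> I \<and> b \<in> I \<and> a \<noteq> b \<and> f a = f b) (ab f)"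
        unfolding ab_def by (rule someI_ex)
      then show "fst (ab f) \<in> I" "snd (ab f) \<in> I" "fst (ab f) \<noteq> snd (ab f)" "f (fst (ab f)) = f (snd (ab f))"
        by (auto simp: case_prod_beta)
    qed
    show ?thesis
    proof (rule sum_sign_reversing[of _ t])
      fix x assume x: "x \<in> ?C - ?CI"
      obtain \<pi> f where xf: "x = (\<pi>, f)" by (cases x)
      note ab' = ab[OF x[unfolded xf]]
      have p: "\<pi> permutes S" using x xf by (auto simp: coloured_perms_def)
      let ?t = "transpose (fst (ab f)) (snd (ab f))"
      have "\<pi> \<circ> ?t permutes S"
        using p ab' I by (intro permutes_compose permutes_swap_id) auto
      moreover have "f (?t y) = f y" for y using ab'(4) by (auto simp: transpose_def)
      then have "\<forall>y. f ((\<pi> \<circ> ?t) y) = f y" using x xf by (auto simp: coloured_perms_def)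
      ultimately show "t x \<in> ?C - ?CI" using x by (auto simp: xf t_def coloured_perms_def)
      show "t (t x) = x" by (simp add: t_def xf fun_eq_iff)
      show "F (t x) = - F x"
        using signed_count_transpose[OF finI p ab'(1-3)] by (simp add: F_def t_def xf)
    qed
  qed
  then have CI: "sum F ?C = sum F ?CI"
    using sum.subset_diff[OF sub finC(1), of F] by simp
  let ?A = "coloured_perms (S - I) S Q I"
  let ?B = "\<lambda>i. coloured_perms (S - (I - {i})) S Q I - ?A"
  have A: "(\<pi>, f) \<in> ?CI \<and> (\<forall>x\<in>I. \<pi> x = x)" if "(\<pi>, f) \<in> ?A" for \<pi> f
    using that permutes_subset[of \<pi> "S - I" S] permutes_not_in[of \<pi> "S - I"]
    unfolding coloured_perms_def by auto
  have A': "(\<pi>, f) \<in> coloured_perms (S - K) S Q I"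
    if "(\<pi>, f) \<in> ?CI" "\<forall>x\<in>K. \<pi> x = x" for \<pi> f K
    using that permutes_superset[of \<pi> S "S - K"] unfolding coloured_perms_def by auto
  have fixI: "\<pi> x = x" if "(\<pi>, f) \<in> ?CI" "x \<in> I" "\<pi> x \<in> I" for \<pi> f x
    using that unfolding coloured_perms_def inj_on_def by auto
  have B: "(\<pi>, f) \<in> ?CI \<and> (\<forall>x\<in>I - {i}. \<pi> x = x) \<and> \<pi> i \<notin> I" if "(\<pi>, f) \<in> ?B i" "i \<in> I" for \<pi> f i
  proof -
    have p: "\<pi> permutes S - (I - {i})" using that by (auto simp: coloured_perms_def)
    have 1: "(\<pi>, f) \<in> ?CI"
      using that permutes_subset[OF p, of S] unfolding coloured_perms_def by auto
    have 2: "\<forall>x\<in>I - {i}. \<pi> x = x" using permutes_not_in[OF p] by auto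
    have "\<pi> i \<noteq> i" using A'[OF 1, of I] 2 that by auto
    then have "\<pi> i \<notin> I" using fixI[OF 1 that(2)] by auto
    then show ?thesis using 1 2 by blast
  qed
  have rest: "F (\<pi>, f) = 0" if x: "(\<pi>, f) \<in> ?CI - (?A \<union> (\<Union>i\<in>I. ?B i))" for \<pi> f
  proof -
    have CIx: "(\<pi>, f) \<in> ?CI" using x by simp
    then have p: "\<pi> permutes S" by (auto simp: coloured_perms_def)
    have "\<not> (\<forall>x\<in>I. \<pi> x = x)" using A'[OF CIx, of I] x by auto
    then obtain a where a: "a \<in> I" "\<pi> a \<noteq> a" by auto
    have "\<not> (\<forall>x\<in>I - {a}. \<pi> x = x)" using A'[OF CIx, of "I - {a}"] x a by auto
    then obtain b where b: "b \<in> I" "b \<noteq> a" "\<pi> b \<noteq> b" by auto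
    \<comment> \<open>A preimage of y in I would be fixed by \<open>fixI\<close>, hence equal to y,
      although y moves. Two moved points of I therefore satisfy the hypotheses of
      \<open>signed_count_eq_0\<close>.\<close>
    have "y \<notin> \<pi> ` I" if "\<pi> y \<noteq> y" "y \<in> I" for y
      using fixI[OF CIx] that by (metis imageE)
    then have "a \<in> I - \<pi> ` I" "b \<in> I - \<pi> ` I" using a b by auto
    from signed_count_eq_0[OF S(1) I(1) p this] b show ?thesis by (simp add: F_def)
  qed
  have disj: "?B i \<inter> ?B j = {}" if "i \<in> I" "j \<in> I" "i \<noteq> j" for i j
  proof -
    have False if "x \<in> ?B i" "x \<in> ?B j" for x
    proof -
      obtain \<pi> f where x: "x = (\<pi>, f)" by (cases x)
      show False using B[of \<pi> f i] B[of \<pi> f j] that \<open>i \<in> I\<close> \<open>j \<in> I\<close> \<open>i \<noteq> j\<close> unfolding x by force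
    qed
    then show ?thesis by blast
  qed
  have finA: "finite ?A" "finite (?B i)" for i
    using S(1) Q by (auto intro!: finite_coloured_perms)
  have subA: "?A \<subseteq> ?CI" using A by (intro subrelI) blast
  have subB: "(\<Union>i\<in>I. ?B i) \<subseteq> ?CI" using B by (intro UN_least subrelI) blast
  have "sum F ?CI = sum F (?A \<union> (\<Union>i\<in>I. ?B i))"
    using finC(2) Un_least[OF subA subB] rest
    by (intro sum.mono_neutral_right) (metis surj_pair)+
  also have "\<dots> = sum F ?A + sum F (\<Union>i\<in>I. ?B i)"
    by (rule sum.union_disjoint) (use finA finI in auto)
  also have "sum F (\<Union>i\<in>I. ?B i) = (\<Sum>i\<in>I. sum F (?B i))"
    by (rule sum.UNION_disjoint) (use finA finI disj in auto)
  also have "sum F ?A = (\<Sum>x\<in>?A. matching_sign (card I) * int (dfact (2 * n - card I - 1)))"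
  proof (rule sum.cong[OF refl])
    fix x assume x: "x \<in> ?A"
    obtain \<pi> f where xf: "x = (\<pi>, f)" by (cases x)
    have "F x = matching_sign (card I) * int (card (matchings (S - I)))"
      using signed_count_fixing[OF S(1) I(1), of \<pi>] A x by (auto simp: F_def xf)
    also have "\<dots> = matching_sign (card I) * int (dfact (2 * n - card I - 1))"
    proof (cases "even (card I)")
      case True
      then obtain k where k: "card I = 2 * k" by auto
      have "card (S - I) = 2 * (n - k)" using S I finI k by (simp add: card_Diff_subset)
      then show ?thesis using card_matchings[of "S - I" "n - k"] S(1) k
        by (simp add: right_diff_distrib')
    qed (simp add: matching_sign_def)
    finally show "F x = matching_sign (card I) * int (dfact (2 * n - card I - 1))" .
  qed
  also have "(\<Sum>i\<in>I. sum F (?B i)) =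
      (\<Sum>i\<in>I. \<Sum>x\<in>?B i. matching_sign (card I - 1) * int (dfact (2 * n - card I - 2)))"
  proof (intro sum.cong refl)
    fix i x assume i: "i \<in> I" and x: "x \<in> ?B i"
    obtain \<pi> f where xf: "x = (\<pi>, f)" by (cases x)
    note Bx = B[OF x[unfolded xf] i]
    have p: "\<pi> permutes S" using Bx by (auto simp: coloured_perms_def)
    have "F x = matching_sign (card I - 1) * int (card (matchings (S - insert (\<pi> i) I)))"
      using signed_count_moving[OF S(1) I(1) p i] Bx by (auto simp: F_def xf)
    also have "\<dots> = matching_sign (card I - 1) * int (dfact (2 * n - card I - 2))"
    proof (cases "even (card I - 1)")
      case True
      then obtain k where "card I - 1 = 2 * k" by (elim evenE)
      moreover have pos: "card I > 0" using i finI by (auto simp: card_gt_0_iff)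
      ultimately have k: "card I = 2 * k + 1" by simp
      have "insert (\<pi> i) I \<subseteq> S" using permutes_in_image[OF p] i I by auto
      then have "card (S - insert (\<pi> i) I) = 2 * (n - k - 1)"
        using S finI k Bx by (simp add: card_Diff_subset)
      then show ?thesis using card_matchings[of "S - insert (\<pi> i) I" "n - k - 1"] S(1) k
        by (simp add: right_diff_distrib')
    qed (simp add: matching_sign_def)
    finally show "F x = matching_sign (card I - 1) * int (dfact (2 * n - card I - 2))" .
  qed
  also have "\<dots> = (\<Sum>i\<in>I. matching_sign (card I - 1) * int (dfact (2 * n - card I - 2)) *
        (int (card (coloured_perms (S - (I - {i})) S Q I)) - int (card ?A)))"
  proof (rule sum.cong[OF refl])
    fix i assume i: "i \<in> I"
    have "?A \<subseteq> coloured_perms (S - (I - {i})) S Q I" using A A' by fastforce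
    then have "card ?A \<le> card (coloured_perms (S - (I - {i})) S Q I)"
      "card (?B i) = card (coloured_perms (S - (I - {i})) S Q I) - card ?A"
      using S(1) Q by (auto intro!: card_mono card_Diff_subset finite_coloured_perms)
    then show "(\<Sum>x\<in>?B i. matching_sign (card I - 1) * int (dfact (2 * n - card I - 2))) =
      matching_sign (card I - 1) * int (dfact (2 * n - card I - 2)) *
        (int (card (coloured_perms (S - (I - {i})) S Q I)) - int (card ?A))"
      by (simp add: of_nat_diff mult.commute)
  qed
  finally show ?thesis using CI unfolding F_def by (simp add: mult_ac)
qed

subsection \<open>A hypergeometric identity\<close>

definition geom :: "real fps" where "geom = inverse (1 - fps_X)"

lemma geom_mult: "(1 - fps_X) * geom = 1"
  unfolding geom_def by (rule inverse_mult_eq_1') simp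

lemma geom_power_nth: "fps_nth (geom ^ Suc m) n = real ((n + m) choose m)"
  using one_minus_const_fps_X_neg_power'[of "Suc m" "1 :: real"] binomial_symmetric[of m "n + m"]
  by (simp add: geom_def fps_inverse_power add.commute del: power_Suc)

lemma fps_XD_mult: "fps_XD (a * b) = fps_XD a * b + a * fps_XD (b :: real fps)"
  by (simp add: fps_XD_def algebra_simps)

lemma fps_XD_power: "fps_XD (a ^ n) = of_nat n * a ^ (n - 1) * fps_XD (a :: real fps)"
  by (simp add: fps_XD_def fps_deriv_power fps_of_nat mult_ac)

lemma fps_XD_geom: "fps_XD geom = fps_X * geom ^ 2"
proof -
  have "fps_deriv ((1 - fps_X) * geom) = 0" by (simp add: geom_mult)
  then have "(1 - fps_X) * fps_deriv geom = geom" by simp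
  then have "geom * ((1 - fps_X) * fps_deriv geom) = geom ^ 2" by (simp add: power2_eq_square)
  moreover have "geom * ((1 - fps_X) * fps_deriv geom) = fps_deriv geom"
    using geom_mult by (simp add: mult.assoc[symmetric] mult.commute[of geom])
  ultimately show ?thesis by (simp add: fps_XD_def)
qed

lemma fps_XD_geom_power: "fps_XD (geom ^ n) = of_nat n * fps_X * geom ^ Suc n"
proof (cases n)
  case (Suc m)
  have "fps_XD (geom ^ n) = of_nat n * geom ^ m * (fps_X * geom ^ 2)"
    by (simp only: fps_XD_power fps_XD_geom Suc diff_Suc_1)
  then show ?thesis by (simp only: Suc power_Suc power2_eq_square mult_ac)
qed (simp add: fps_XD_def)

text \<open>\<open>fps_XD\<close> multiplies the coefficient of X^j by j. Applied twice to the
  product it produces the factor x^2 in the coefficient of X^x, and the second summand multiplies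
  the term X^(2a) of A by (2p+1) 2a - (2a)^2. The left side is thus built to carry the weight x^2 +
  2a(2p+1-2a).\<close>

lemma fps_identity:
  fixes p :: nat
  defines "A \<equiv> (1 - fps_X ^ 2) ^ p :: real fps"
  shows "fps_XD (fps_XD (A * geom ^ (2 * p + 1)))
           + (of_nat (2 * p + 1) * fps_XD A - fps_XD (fps_XD A)) * geom ^ (2 * p + 1)
         = of_nat (2 * p + 1) * (fps_X * (1 + fps_X) ^ (p + 1) * geom ^ (p + 3))"
proof -
  define H where "H = geom ^ (2 * p + 1)"
  define c :: "real fps" where "c = of_nat (2 * p + 1)"
  let ?X = "fps_X :: real fps"
  have XDX: "fps_XD ?X = ?X" by (simp add: fps_XD_def)
  have XDc: "fps_XD c = 0" by (simp add: c_def fps_XD_def)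
  have H1: "fps_XD H = c * ?X * (geom * H)"
    unfolding H_def c_def fps_XD_geom_power by simp
  have H2: "fps_XD (fps_XD H) = c * ?X * geom * H + c * ?X * (?X * geom ^ 2) * H + c * ?X * geom * (c * ?X * (geom * H))"
    unfolding H1 fps_XD_mult XDc XDX fps_XD_geom H1 by (simp add: algebra_simps)
  \<comment> \<open>The second derivative of A cancels, and all remaining terms are multiples of
    \<open>c * H\<close>, since \<open>fps_XD H\<close> is one.\<close>
  have "fps_XD (fps_XD (A * H)) + (c * fps_XD A - fps_XD (fps_XD A)) * H
      = 2 * fps_XD A * fps_XD H + A * fps_XD (fps_XD H) + c * H * fps_XD A"
    by (simp add: fps_XD_mult algebra_simps)
  also have "\<dots> = c * (H * (fps_XD A * (2 * ?X * geom + 1) + A * ?X * geom * (1 + (c + 1) * ?X * geom)))"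
    unfolding H2 unfolding H1 by (simp add: algebra_simps power2_eq_square)
  also have "H * (fps_XD A * (2 * ?X * geom + 1) + A * ?X * geom * (1 + (c + 1) * ?X * geom))
      = ?X * (1 + ?X) ^ (p + 1) * geom ^ (p + 3)"
  proof -
    have g: "geom = 1 + ?X * geom" using geom_mult by (simp add: algebra_simps)
    then have g2: "2 * ?X * geom + 1 = (1 + ?X) * geom" by (simp add: algebra_simps)
    \<comment> \<open>The case p = 0 is separate because \<open>fps_XD A\<close> involves the power
      p - 1 of 1 - X^2, which is factored out as B otherwise.\<close>
    show ?thesis
    proof (cases p)
      case 0
      then have "H * (fps_XD A * (2 * ?X * geom + 1) + A * ?X * geom * (1 + (c + 1) * ?X * geom)) =
         geom * ?X * geom * (2 * ?X * geom + 1)"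
        by (simp add: A_def H_def c_def fps_XD_def)
      then show ?thesis unfolding g2 0 by (simp add: power3_eq_cube)
    next
      case (Suc q)
      define B where "B = (1 - ?X ^ 2) ^ q"
      have f: "1 - ?X ^ 2 = (1 + ?X) * (1 - ?X)" by (simp add: algebra_simps power2_eq_square)
      have A: "A = B * (1 + ?X) * (1 - ?X)" by (simp add: A_def B_def Suc f)
      have "fps_XD (1 - ?X ^ 2) = - 2 * ?X ^ 2"
        by (simp add: fps_XD_def power2_eq_square algebra_simps)
      then have XA: "fps_XD A = - 2 * of_nat p * ?X ^ 2 * B"
        unfolding A_def B_def fps_XD_power by (simp add: Suc algebra_simps)
      have c1: "c + 1 = 2 * of_nat p + 2" by (simp add: c_def)
      have "A * ?X * geom = ((1 - ?X) * geom) * (B * (1 + ?X) * ?X)" unfolding A by (simp only: mult_ac)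
      then have AX: "A * ?X * geom = B * (1 + ?X) * ?X" by (simp only: geom_mult mult_1_left)
      have "fps_XD A * (2 * ?X * geom + 1) + A * ?X * geom * (1 + (c + 1) * ?X * geom)
          = fps_XD A * ((1 + ?X) * geom) + A * ?X * geom * (1 + (c + 1) * ?X * geom)"
        by (simp only: g2)
      also have "\<dots> = B * ?X * (1 + ?X) * (2 * ?X * geom + 1)"
        unfolding XA AX c1 by (simp add: algebra_simps power2_eq_square)
      also have "H * \<dots> = (1 + ?X) ^ (q + 2) * ?X * ((1 - ?X) * geom) ^ q * geom ^ (q + 4)"
        unfolding g2 H_def B_def f power_mult_distrib Suc
        by (simp add: power_add power_mult power2_eq_square eval_nat_numeral mult_ac)
      finally show ?thesis unfolding geom_mult power_one by (simp add: Suc eval_nat_numeral mult_ac)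
    qed
  qed
  finally show ?thesis unfolding c_def H_def by (simp only: mult.assoc)
qed

text \<open>Both sides are the coefficient of X^x in \<open>fps_identity\<close>. On the right,
  (1+X)/(1-X) = 1 + 2X/(1-X) is expanded by the binomial theorem, which is the origin of the powers
  of 2; X^(k+1)/(1-X)^(k+2) has coefficient \<open>x choose Suc k\<close>.\<close>

lemma hypergeometric_identity:
  "(\<Sum>a\<le>p. (-1) ^ a * real (p choose a) * real ((x + 2 * p - 2 * a) choose (2 * p))
       * (real x ^ 2 + 2 * real a * (2 * real p + 1 - 2 * real a)))
   = (2 * real p + 1) * (\<Sum>k\<le>p + 1. 2 ^ k * real ((p + 1) choose k) * real (x choose Suc k))"
proof -
  define A :: "real fps" where "A = (1 - fps_X ^ 2) ^ p"
  let ?G = "geom ^ (2 * p + 1)"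
  define w where "w a = fps_const ((-1) ^ a * real (p choose a))" for a
  have A: "A = (\<Sum>a\<le>p. w a * fps_X ^ (2 * a))"
  proof -
    have "A = (- (fps_X ^ 2) + 1) ^ p" by (simp add: A_def)
    also have "\<dots> = (\<Sum>a\<le>p. of_nat (p choose a) * (- (fps_X ^ 2)) ^ a * 1 ^ (p - a))"
      by (rule binomial_ring)
    also have "\<dots> = (\<Sum>a\<le>p. w a * fps_X ^ (2 * a))"
    proof (rule sum.cong[OF refl])
      fix a
      have "(- (fps_X ^ 2 :: real fps)) ^ a = fps_const ((-1) ^ a) * fps_X ^ (2 * a)"
        by (subst power_minus) (simp add: power_mult fps_const_power[symmetric] fps_const_neg[symmetric] del: fps_const_neg)
      then show "of_nat (p choose a) * (- (fps_X ^ 2)) ^ a * 1 ^ (p - a) = w a * fps_X ^ (2 * a)"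
        by (simp add: w_def fps_of_nat[symmetric] mult_ac del: fps_const_mult)
          (simp add: fps_const_mult[symmetric] fps_of_nat mult_ac del: fps_const_mult)
    qed
    finally show ?thesis .
  qed
  have XDsum: "fps_XD (sum f S) = (\<Sum>a\<in>S. fps_XD (f a))" for f :: "nat \<Rightarrow> real fps" and S
    by (simp add: fps_eq_iff fps_sum_nth sum_distrib_left)
  have XDt: "fps_XD (w a * fps_X ^ (2 * a)) = fps_const (2 * real a) * (w a * fps_X ^ (2 * a))" for a
    by (simp add: fps_eq_iff w_def)
  have E: "of_nat (2 * p + 1) * fps_XD A - fps_XD (fps_XD A)
      = (\<Sum>a\<le>p. fps_const (2 * real a * (2 * real p + 1 - 2 * real a)) * (w a * fps_X ^ (2 * a)))"
  proof -
    have "(of_nat (2 * p + 1) :: real fps) = fps_const (real (2 * p + 1))" by (simp only: fps_of_nat)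
    moreover have "fps_const d * (fps_const c * t) - fps_const c * (fps_const c * t)
        = fps_const (c * (d - c)) * t" for c d :: real and t
      by (simp add: fps_eq_iff algebra_simps)
    moreover have "real (2 * p + 1) = 2 * real p + 1" by simp
    ultimately have "of_nat (2 * p + 1) * (fps_const c * t) - fps_const c * (fps_const c * t)
        = fps_const (c * (2 * real p + 1 - c)) * t" for c t
      by metis
    then show ?thesis
      unfolding A XDsum XDt fps_XD_mult_const sum_distrib_left sum_subtractf[symmetric] by simp
  qed
  have nth: "fps_nth (w a * fps_X ^ (2 * a) * ?G) x
      = (-1) ^ a * real (p choose a) * real ((x + 2 * p - 2 * a) choose (2 * p))" if "a \<le> p" for a
  proof -
    have "fps_nth (fps_X ^ (2 * a) * ?G) x = real ((x + 2 * p - 2 * a) choose (2 * p))"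
    proof (cases "x < 2 * a")
      case False
      then show ?thesis using geom_power_nth[of "2 * p" "x - 2 * a"]
        by (simp add: fps_X_power_mult_nth del: power_Suc)
    qed (use that in \<open>simp add: fps_X_power_mult_nth\<close>)
    then show ?thesis unfolding w_def by (simp add: mult.assoc)
  qed
  define t where "t a = (-1) ^ a * real (p choose a) * real ((x + 2 * p - 2 * a) choose (2 * p))" for a
  have AG: "fps_nth (A * ?G) x = (\<Sum>a\<le>p. t a)"
    unfolding A sum_distrib_right fps_sum_nth t_def by (intro sum.cong refl nth) simp
  have EG: "fps_nth ((\<Sum>a\<le>p. fps_const (e a) * (w a * fps_X ^ (2 * a))) * ?G) x
      = (\<Sum>a\<le>p. e a * t a)" for e
    unfolding sum_distrib_right fps_sum_nth mult.assoc[of "fps_const _"] fps_mult_left_const_nth t_def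
    by (intro sum.cong refl arg_cong2[where f = "(*)"] nth) simp
  have "fps_nth (fps_XD (fps_XD (A * ?G)) + (of_nat (2 * p + 1) * fps_XD A - fps_XD (fps_XD A)) * ?G) x
     = (\<Sum>a\<le>p. t a * (real x ^ 2 + 2 * real a * (2 * real p + 1 - 2 * real a)))"
    unfolding E fps_add_nth fps_XD_nth AG EG
    by (simp add: sum_distrib_left sum.distrib[symmetric] power2_eq_square algebra_simps)
  moreover have "fps_X * (1 + fps_X) ^ (p + 1) * geom ^ (p + 3)
      = (\<Sum>k\<le>p + 1. fps_const (2 ^ k * real ((p + 1) choose k)) * (fps_X ^ Suc k * geom ^ Suc (Suc k)))"
  proof -
    have "(1 + fps_X) * geom = 2 * fps_X * geom + 1" using geom_mult by (simp add: algebra_simps)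
    then have "fps_X * (1 + fps_X) ^ (p + 1) * geom ^ (p + 3)
       = fps_X * geom ^ 2 * (2 * fps_X * geom + 1) ^ (p + 1)"
      by (simp add: power_mult_distrib[symmetric] power2_eq_square eval_nat_numeral mult_ac)
    also have "(2 * fps_X * geom + 1) ^ (p + 1)
       = (\<Sum>k\<le>p + 1. of_nat ((p + 1) choose k) * (2 * fps_X * geom) ^ k * 1 ^ (p + 1 - k))"
      by (rule binomial_ring)
    also have "fps_X * geom ^ 2 * \<dots>
       = (\<Sum>k\<le>p + 1. fps_const (2 ^ k * real ((p + 1) choose k)) * (fps_X ^ Suc k * geom ^ Suc (Suc k)))"
      unfolding sum_distrib_left
      by (intro sum.cong refl)
        (simp add: fps_of_nat[symmetric] power_mult_distrib power2_eq_square mult_ac numeral_fps_const fps_const_power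
           fps_const_mult[symmetric] del: binomial_Suc_Suc fps_const_mult)
    finally show ?thesis .
  qed
  moreover have "fps_nth (fps_X ^ Suc k * geom ^ Suc (Suc k)) x = real (x choose Suc k)" for k
    using geom_power_nth[of "Suc k" "x - Suc k"]
    by (cases "x < Suc k") (simp_all only: fps_X_power_mult_nth if_True if_False, simp_all del: power_Suc)
  ultimately show ?thesis
    using arg_cong[OF fps_identity[of p], of "\<lambda>f. fps_nth f x"]
    by (simp add: A_def t_def fps_sum_nth fps_of_nat[symmetric] del: power_Suc of_nat_Suc of_nat_mult of_nat_add)
qed

section \<open>Double factorials and the pairing of the sizes 2a and 2a + 1\<close>

lemma dfact_odd: "dfact (2 * k + 1) = (2 * k + 1) * dfact (2 * k - 1)"
  by (cases k) auto

lemma fact_double: "fact (2 * k) = real (dfact (2 * k - 1)) * 2 ^ k * fact k"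
proof (induction k)
  case (Suc k)
  have "fact (2 * Suc k) = (2 * real k + 2) * ((2 * real k + 1) * fact (2 * k))"
    by (simp add: algebra_simps)
  also have "\<dots> = (real (2 * k + 1) * real (dfact (2 * k - 1))) * 2 ^ Suc k * fact (Suc k)"
    unfolding Suc by (simp add: algebra_simps)
  also have "real (2 * k + 1) * real (dfact (2 * k - 1)) = real (dfact (2 * Suc k - 1))"
    using dfact_odd[of k] by (simp only: of_nat_mult[symmetric]) simp
  finally show ?case .
qed simp

lemma sum_even_odd:
  "(\<Sum>k\<le>2 * p + 1. g k) = (\<Sum>a\<le>p. g (2 * a) + g (2 * a + 1 :: nat) :: 'a :: comm_monoid_add)"
  by (induction p) (simp_all add: add_ac)

text \<open>The falling factorial q, ..., q-2a+1 and the rising factorial q+1, ..., q+2b join to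
  2(a+b) consecutive factors with top factor q+2b.\<close>

lemma fact_gbinomial_pochhammer:
  "fact (2 * a) * (real q gchoose (2 * a)) * pochhammer (real q + 1) (2 * b)
     = fact (2 * (a + b)) * real ((q + 2 * b) choose (2 * (a + b)))"
proof -
  have "fact (2 * (a + b)) * real ((q + 2 * b) choose (2 * (a + b))) = pochhammer (real q - 2 * real a + 1) (2 * a + 2 * b)"
    by (simp add: binomial_gbinomial gbinomial_pochhammer' algebra_simps)
  also have "\<dots> = pochhammer (real q - 2 * real a + 1) (2 * a) * pochhammer (real q + 1) (2 * b)"
    by (subst pochhammer_product') simp
  also have "pochhammer (real q - 2 * real a + 1) (2 * a) = fact (2 * a) * (real q gchoose (2 * a))"
    by (simp add: gbinomial_pochhammer')
  finally show ?thesis ..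
qed

text \<open>After the two binomials are related by (2a+1) and (2b+1), the terms of sizes 2a and 2a+1
  share everything except q(q+1+2b) and (q-2a)(2b+1). The difference of these is q^2 + 2a(2b+1), the
  quadratic weight of \<open>hypergeometric_identity\<close>.\<close>

lemma alternating_term:
  fixes a b q :: nat
  defines "p \<equiv> a + b"
  shows "real ((2 * p + 1) choose (2 * a)) * (real (dfact (2 * a - 1)) * real (dfact (2 * b + 1)) *
           (fact (2 * a) * (real q gchoose (2 * a)) * pochhammer (real q) (2 * b + 2)))
       - real ((2 * p + 1) choose (2 * a + 1)) * ((2 * real a + 1) * (real (dfact (2 * a - 1)) * real (dfact (2 * b - 1))) *
           (fact (2 * a + 1) * (real q gchoose (2 * a + 1)) *
             (pochhammer (real q + 1) (2 * b + 1) - pochhammer (real q) (2 * b + 1))))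
       = fact (2 * p + 1) * real (dfact (2 * p - 1)) *
         (real (p choose a) * real ((q + 2 * p - 2 * a) choose (2 * p)) *
           (real q ^ 2 + 2 * real a * (2 * real p + 1 - 2 * real a)))"
proof -
  define D where "D k = real (dfact (2 * k - 1))" for k
  define P where "P = pochhammer (real q + 1) (2 * b)"
  define G where "G = fact (2 * a) * (real q gchoose (2 * a))"
  define C where "C = real ((2 * p + 1) choose (2 * a))"
  have Db: "real (dfact (2 * b + 1)) = (2 * real b + 1) * D b"
    using dfact_odd[of b] by (simp add: D_def algebra_simps)
  have G1: "fact (2 * a + 1) * (real q gchoose (2 * a + 1)) = G * (real q - 2 * real a)"
    unfolding G_def gbinomial_mult_fact by simp
  have P1: "pochhammer (real q + 1) (2 * b + 1) = P * (real q + 1 + 2 * real b)"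
    by (simp add: P_def pochhammer_Suc)
  have P2: "pochhammer (real q) (2 * b + 1) = real q * P"
    by (simp add: P_def pochhammer_rec)
  have P3: "pochhammer (real q) (2 * b + 2) = real q * (P * (real q + 1 + 2 * real b))"
    using P1 by (simp add: pochhammer_rec)
  have C1: "real ((2 * p + 1) choose (2 * a + 1)) * (2 * real a + 1) = C * (2 * real b + 1)"
  proof -
    have fs: "fact (2 * k + 1) = (2 * real k + 1) * fact (2 * k)" for k by simp
    have 1: "real ((2 * p + 1) choose (2 * a + 1)) = fact (2 * p + 1) / (fact (2 * a + 1) * fact (2 * b))"
      by (subst binomial_fact) (auto simp: p_def)
    have 2: "C = fact (2 * p + 1) / (fact (2 * a) * fact (2 * b + 1))"
      unfolding C_def by (subst binomial_fact) (auto simp: p_def)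
    have "2 * real k + 1 \<noteq> 0" for k by (simp add: add_nonneg_eq_0_iff)
    then show ?thesis unfolding 1 2 fs by (simp add: divide_simps)
  qed
  have "C * D a * ((2 * real b + 1) * D b) * (G * P) * 
      (real q * (real q + 1 + 2 * real b) - (real q - 2 * real a) * (2 * real b + 1))
    = C * D a * ((2 * real b + 1) * D b) * (fact (2 * p) * real ((q + 2 * b) choose (2 * p))) *
        (real q ^ 2 + 2 * real a * (2 * real b + 1))"
  proof -
    have "G * P = fact (2 * p) * real ((q + 2 * b) choose (2 * p))"
      unfolding G_def P_def p_def by (rule fact_gbinomial_pochhammer)
    then show ?thesis by (simp add: algebra_simps power2_eq_square)
  qed
  also have "C * D a * ((2 * real b + 1) * D b) * (fact (2 * p) * real ((q + 2 * b) choose (2 * p)))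
      = fact (2 * p + 1) * D p * real (p choose a) * real ((q + 2 * b) choose (2 * p))"
  proof -
    have "C = fact (2 * p + 1) / (fact (2 * a) * fact (2 * b + 1))"
      unfolding C_def by (subst binomial_fact) (auto simp: p_def)
    also have "fact (2 * b + 1) = (2 * real b + 1) * fact (2 * b)" by simp
    finally have C: "C = fact (2 * p + 1) / (D a * 2 ^ a * fact a * ((2 * real b + 1) * (D b * 2 ^ b * fact b)))"
      unfolding fact_double D_def .
    have nz: "D k \<noteq> 0" for k
      using fact_double[of k] unfolding D_def by (metis fact_nonzero mult_zero_left)
    have pa: "real (p choose a) = fact p / (fact a * fact b)"
      by (subst binomial_fact) (auto simp: p_def)
    have f: "fact (2 * p) = D p * (2 ^ a * 2 ^ b) * fact p"
      unfolding fact_double D_def by (simp add: p_def power_add)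
    have alg: "F / (x * u * f * (z * (y * v * g))) * x * (z * y) * (w * (u * v) * h * R) = F * w * (h / (f * g)) * R"
      if "x \<noteq> 0" "u \<noteq> 0" "f \<noteq> 0" "z \<noteq> 0" "y \<noteq> 0" "v \<noteq> 0" "g \<noteq> 0" for F x u f z y v g w h R :: real
      using that by (simp add: field_simps)
    show ?thesis unfolding C pa f
      by (rule alg) (use nz in \<open>auto simp: add_nonneg_eq_0_iff\<close>)
  qed
  finally have main: "C * D a * ((2 * real b + 1) * D b) * (G * P) * 
      (real q * (real q + 1 + 2 * real b) - (real q - 2 * real a) * (2 * real b + 1))
    = fact (2 * p + 1) * D p * real (p choose a) * real ((q + 2 * b) choose (2 * p)) *
        (real q ^ 2 + 2 * real a * (2 * real b + 1))" .
  have "C * (D a * ((2 * real b + 1) * D b) * (G * (real q * (P * (real q + 1 + 2 * real b)))))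
      - C' * ((2 * real a + 1) * (D a * D b) * (G * (real q - 2 * real a) * (P * (real q + 1 + 2 * real b) - real q * P)))
    = C * D a * ((2 * real b + 1) * D b) * (G * P) * 
      (real q * (real q + 1 + 2 * real b) - (real q - 2 * real a) * (2 * real b + 1))"
    if "C' * (2 * real a + 1) = C * (2 * real b + 1)" for C'
  proof -
    have "C' * ((2 * real a + 1) * (D a * D b) * (G * (real q - 2 * real a) * (P * (real q + 1 + 2 * real b) - real q * P)))
      = (C' * (2 * real a + 1)) * (D a * D b * (G * (real q - 2 * real a) * (P * (1 + 2 * real b))))"
      by (simp add: algebra_simps)
    then show ?thesis unfolding that by (simp add: algebra_simps)
  qed
  note this[OF C1]
  moreover have "q + 2 * p - 2 * a = q + 2 * b" "2 * real p + 1 - 2 * real a = 2 * real b + 1"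
    by (simp_all add: p_def)
  ultimately show ?thesis
    using main unfolding Db G1 P1 P2 P3 C_def[symmetric] G_def[symmetric] D_def[symmetric]
    by (simp only: mult.assoc)
qed

subsection \<open>The enumeration of one-face maps\<close>

lemma sum_Pow_card:
  assumes "finite A"
  shows "(\<Sum>I | I \<subseteq> A. g (card I)) = (\<Sum>k\<le>card A. real (card A choose k) * g k)"
proof -
  have "(\<Sum>I | I \<subseteq> A. g (card I)) = (\<Sum>k\<le>card A. \<Sum>I | I \<in> {I. I \<subseteq> A} \<and> card I = k. g (card I))"
    by (rule sum.group[symmetric]) (use assms in \<open>auto intro: card_mono\<close>)
  also have "\<dots> = (\<Sum>k\<le>card A. real (card A choose k) * g k)"
    using n_subsets[OF assms] by (intro sum.cong refl) simp
  finally show ?thesis .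
qed

text \<open>The value of \<open>\<Sum>(\<pi>, f). signed_count S I \<pi>\<close> for \<open>|S| = N\<close>, \<open>|I| = k\<close> and \<open>q\<close> colours: the first
  summand comes from the \<open>\<pi>\<close> fixing \<open>I\<close> pointwise, the second from the \<open>\<pi>\<close> moving exactly one
  point of \<open>I\<close>.\<close>

definition signed_total :: "nat \<Rightarrow> nat \<Rightarrow> nat \<Rightarrow> real" where
  "signed_total N q k =
     of_int (matching_sign k) * real (dfact (N - k - 1)) *
       (fact k * (real q gchoose k) * pochhammer (real q) (N - k))
   + real k * (of_int (matching_sign (k - 1)) * real (dfact (N - k - 2)) *
       (fact k * (real q gchoose k) * (pochhammer (real q + 1) (N - k) - pochhammer (real q) (N - k))))"

lemma card_coloured_perms_fixing:
  assumes "finite S" "finite Q" "I \<subseteq> S"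
  shows "real (card (coloured_perms (S - I) S Q I)) =
     fact (card I) * (real (card Q) gchoose card I) * pochhammer (real (card Q)) (card S - card I)"
proof -
  have fin: "finite I" using assms finite_subset by auto
  have "real (card (coloured_perms ({} \<union> (S - I)) (I \<union> (S - I)) Q I)) =
      real (pochhammer (card Q + 0) (card (S - I))) * real (card (coloured_perms {} I Q I))"
    using card_coloured_perms_Un[of "S - I" "{}" I Q I] assms fin
    by (simp add: Int_commute)
  then show ?thesis
    using card_coloured_perms_base[of I Q "{}"] assms fin
    by (simp add: Un_absorb1 pochhammer_of_nat card_Diff_subset)
qed

lemma card_coloured_perms_fixing_but_one:
  assumes "finite S" "finite Q" "I \<subseteq> S" "i \<in> I"
  shows "real (card (coloured_perms (S - (I - {i})) S Q I)) =
     fact (card I) * (real (card Q) gchoose card I) * pochhammer (real (card Q) + 1) (card S - card I)"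
proof -
  have fin: "finite I" using assms finite_subset by auto
  have eq: "S - (I - {i}) = {i} \<union> (S - I)" "S = I \<union> (S - I)" using assms by auto
  have "real (card (coloured_perms ({i} \<union> (S - I)) (I \<union> (S - I)) Q I)) =
      real (pochhammer (card Q + 1) (card (S - I))) * real (card (coloured_perms {i} I Q I))"
    using card_coloured_perms_Un[of "S - I" "{i}" I Q I] assms fin
    by (simp add: Int_commute)
  moreover have "real (card (coloured_perms {i} I Q I)) = fact (card I) * (real (card Q) gchoose card I)"
    by (rule card_coloured_perms_base) (use assms fin in auto)
  moreover have "real (pochhammer (card Q + 1) (card (S - I))) = pochhammer (real (card Q) + 1) (card S - card I)"
    using assms fin by (simp add: pochhammer_of_nat[symmetric] card_Diff_subset add.commute)
  ultimately show ?thesis unfolding eq(1) using eq(2) by simp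
qed

lemma signed_total_eq:
  fixes S :: "'a set" and Q :: "'b set"
  assumes S: "finite S" "card S = 2 * n" and Q: "finite Q" and I: "I \<subseteq> S" "I \<noteq> S"
  shows "of_int (\<Sum>(\<pi>, f)\<in>coloured_perms S S Q {}. signed_count S I \<pi>) = signed_total (2 * n) (card Q) (card I)"
proof -
  show ?thesis
    unfolding sum_signed_count_coloured_perms[OF S Q I] signed_total_def
    using card_coloured_perms_fixing[OF S(1) Q I(1)]
      card_coloured_perms_fixing_but_one[OF S(1) Q I(1)]
    by (simp add: S(2) right_diff_distrib)
qed

lemma signed_total_even_odd:
  fixes a b q :: nat
  defines "p \<equiv> a + b"
  shows "real ((2 * p + 1) choose (2 * a)) * ((-1) ^ (2 * a) * signed_total (2 * p + 2) q (2 * a))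
       + real ((2 * p + 1) choose (2 * a + 1)) * ((-1) ^ (2 * a + 1) * signed_total (2 * p + 2) q (2 * a + 1))
       = fact (2 * p + 1) * real (dfact (2 * p - 1)) *
         ((-1) ^ a * real (p choose a) * real ((q + 2 * p - 2 * a) choose (2 * p)) *
           (real q ^ 2 + 2 * real a * (2 * real p + 1 - 2 * real a)))"
proof -
  have ev: "signed_total (2 * p + 2) q (2 * a) = (-1) ^ a * (real (dfact (2 * a - 1)) * real (dfact (2 * b + 1)) *
           (fact (2 * a) * (real q gchoose (2 * a)) * pochhammer (real q) (2 * b + 2)))"
  proof -
    \<comment> \<open>The one-moved-point summand vanishes for even size: if a > 0 then 2a - 1 is
      odd, and if a = 0 the truncated argument gives \<open>matching_sign 0 = 1\<close> but the
      prefactor is 0.\<close>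
    have "real (2 * a) * of_int (matching_sign (2 * a - 1)) = 0"
      by (cases a) (auto simp: matching_sign_def)
    moreover have "2 * p + 2 - 2 * a = 2 * b + 2" by (simp add: p_def)
    ultimately show ?thesis
      unfolding signed_total_def mult.assoc[symmetric, of "real (2 * a)"]
      by (simp add: matching_sign_def)
  qed
  have od: "signed_total (2 * p + 2) q (2 * a + 1) = (-1) ^ a * ((2 * real a + 1) * (real (dfact (2 * a - 1)) * real (dfact (2 * b - 1))) *
           (fact (2 * a + 1) * (real q gchoose (2 * a + 1)) *
             (pochhammer (real q + 1) (2 * b + 1) - pochhammer (real q) (2 * b + 1))))"
  proof -
    have "2 * p + 2 - (2 * a + 1) = 2 * b + 1" by (simp add: p_def)
    moreover have "2 * p + 2 - (2 * a + 1) - 2 = 2 * b - 1" by (simp add: p_def)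
    ultimately show ?thesis
      unfolding signed_total_def by (simp add: matching_sign_def)
  qed
  have "real ((2 * p + 1) choose (2 * a)) * ((-1) ^ (2 * a) * ((-1) ^ a * X))
       + real ((2 * p + 1) choose (2 * a + 1)) * ((-1) ^ (2 * a + 1) * ((-1) ^ a * Y))
      = (-1) ^ a * (real ((2 * p + 1) choose (2 * a)) * X - real ((2 * p + 1) choose (2 * a + 1)) * Y)" for X Y
  proof -
    have "(-1) ^ (2 * a) = (1 :: real)" "(-1) ^ (2 * a + 1) = (- 1 :: real)" by simp_all
    then show ?thesis by (simp only: algebra_simps)
  qed
  note signs = this
  show ?thesis
    unfolding ev od signs alternating_term[of a b q, folded p_def] by (simp only: mult_ac)
qed

text \<open>With n = p + 1 the sizes 0, ..., 2p+1 split into pairs 2a, 2a+1 with a \<le> p. The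
  factor 2p+1 of the hypergeometric identity completes (2p-1)!! to (2n-1)!!.\<close>

lemma sum_signed_total:
  assumes "n \<ge> 1"
  shows "(\<Sum>k\<le>2 * n - 1. real ((2 * n - 1) choose k) * ((-1) ^ k * signed_total (2 * n) q k))
     = fact (2 * n - 1) * real (dfact (2 * n - 1)) *
       (\<Sum>k\<le>n. 2 ^ k * real (n choose k) * real (q choose Suc k))"
proof -
  obtain p where n: "n = p + 1" using assms by (metis add.commute le_Suc_ex)
  have N: "2 * n - 1 = 2 * p + 1" "2 * n = 2 * p + 2" by (simp_all add: n)
  let ?t = "\<lambda>a. (-1) ^ a * real (p choose a) * real ((q + 2 * p - 2 * a) choose (2 * p)) *
           (real q ^ 2 + 2 * real a * (2 * real p + 1 - 2 * real a))"
  have "(\<Sum>k\<le>2 * n - 1. real ((2 * n - 1) choose k) * ((-1) ^ k * signed_total (2 * n) q k))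
     = (\<Sum>a\<le>p. fact (2 * p + 1) * real (dfact (2 * p - 1)) * ?t a)"
    unfolding N(1) unfolding N(2) sum_even_odd
  proof (rule sum.cong[OF refl])
    fix a assume "a \<in> {..p}"
    then obtain b where b: "p = a + b" using le_Suc_ex by auto
    show "real ((2 * p + 1) choose (2 * a)) * ((-1) ^ (2 * a) * signed_total (2 * p + 2) q (2 * a))
       + real ((2 * p + 1) choose (2 * a + 1)) * ((-1) ^ (2 * a + 1) * signed_total (2 * p + 2) q (2 * a + 1))
       = fact (2 * p + 1) * real (dfact (2 * p - 1)) * ?t a"
      unfolding b by (rule signed_total_even_odd)
  qed
  also have "\<dots> = fact (2 * p + 1) * real (dfact (2 * p - 1)) * (\<Sum>a\<le>p. ?t a)"
    by (simp only: sum_distrib_left)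
  also have "(\<Sum>a\<le>p. ?t a) = (2 * real p + 1) * (\<Sum>k\<le>n. 2 ^ k * real (n choose k) * real (q choose Suc k))"
    unfolding n by (rule hypergeometric_identity)
  also have "fact (2 * p + 1) * real (dfact (2 * p - 1)) * \<dots> = fact (2 * p + 1) * ((2 * real p + 1) * real (dfact (2 * p - 1))) * 
       (\<Sum>k\<le>n. 2 ^ k * real (n choose k) * real (q choose Suc k))"
    by (simp only: mult_ac)
  also have "(2 * real p + 1) * real (dfact (2 * p - 1)) = real (dfact (2 * n - 1))"
    unfolding N(1) dfact_odd by (simp add: algebra_simps)
  finally show ?thesis unfolding N(1) .
qed

text \<open>Once the sums are interchanged, the contribution of I depends only on its size, so the
  sum over subsets of S - {e} collapses to one with weights \<open>(2 * n - 1) choose k\<close>.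
  Avoiding e also ensures I \<noteq> S, as \<open>signed_total_eq\<close> demands.\<close>

lemma sum_full_cycle_pairs:
  fixes S :: "'a set"
  assumes S: "finite S" "card S = 2 * n" and n: "n \<ge> 1" and e: "e \<in> S"
  shows "(\<Sum>(\<sigma>, \<pi>) | \<sigma> \<in> matchings S \<and> \<pi> permutes S \<and> orbit (\<sigma> \<circ> \<pi>) e = S. real q ^ num_cycles \<pi> S)
     = fact (2 * n - 1) * real (dfact (2 * n - 1)) *
       (\<Sum>k\<le>n. 2 ^ k * real (n choose k) * real (q choose Suc k))"
proof -
  define Q where "Q = {..<q}"
  have Q: "finite Q" "card Q = q" by (simp_all add: Q_def)
  let ?M = "matchings S" and ?P = "{\<pi>. \<pi> permutes S}" and ?C = "coloured_perms S S Q {}"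
  let ?F = "\<lambda>\<pi>. {f \<in> S \<rightarrow>\<^sub>E Q. \<forall>x. f (\<pi> x) = f x}"
  let ?ind = "\<lambda>\<sigma> \<pi>. if orbit (\<sigma> \<circ> \<pi>) e = S then 1 else 0 :: int"
  have fin: "finite ?M" "finite ?P" "finite ?C"
    using S(1) Q(1) by (auto intro: finite_matchings finite_permutations finite_coloured_perms)
  have finF: "finite (?F \<pi>)" for \<pi>
    by (rule finite_subset[OF _ finite_PiE[of S "\<lambda>_. Q"]]) (use S(1) Q(1) in auto)
  have C: "?C = Sigma ?P ?F" by (auto simp: coloured_perms_def)
  have sp: "\<sigma> \<circ> \<pi> permutes S" if "\<sigma> \<in> ?M" "\<pi> permutes S" for \<sigma> \<pi>
    using that by (auto simp: matchings_def intro: permutes_compose)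
  have "(\<Sum>(\<sigma>, \<pi>) | \<sigma> \<in> ?M \<and> \<pi> permutes S \<and> orbit (\<sigma> \<circ> \<pi>) e = S. real q ^ num_cycles \<pi> S)
      = (\<Sum>(\<sigma>, \<pi>) \<in> {x \<in> ?M \<times> ?P. orbit (fst x \<circ> snd x) e = S}. real q ^ num_cycles \<pi> S)"
    by (rule sum.cong) auto
  also have "\<dots> = (\<Sum>x\<in>?M \<times> ?P. if orbit (fst x \<circ> snd x) e = S then real q ^ num_cycles (snd x) S else 0)"
    by (subst sum.inter_filter) (use fin in \<open>auto simp: case_prod_beta intro!: sum.cong\<close>)
  also have "\<dots> = (\<Sum>\<sigma>\<in>?M. \<Sum>\<pi>\<in>?P. real_of_int (?ind \<sigma> \<pi>) * real q ^ num_cycles \<pi> S)"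
    unfolding sum.cartesian_product case_prod_beta by (intro sum.cong) auto
  also have "\<dots> = (\<Sum>\<pi>\<in>?P. \<Sum>\<sigma>\<in>?M. real_of_int (?ind \<sigma> \<pi>) * real (card (?F \<pi>)))"
    by (subst sum.swap) (use card_invariant_colourings[OF S(1), where Q = Q] Q(2) in \<open>auto intro!: sum.cong\<close>)
  also have "\<dots> = real_of_int (\<Sum>\<pi>\<in>?P. \<Sum>f\<in>?F \<pi>. \<Sum>\<sigma>\<in>?M. ?ind \<sigma> \<pi>)"
    by (simp add: sum_distrib_left sum_distrib_right mult.commute)
  also have "(\<Sum>\<pi>\<in>?P. \<Sum>f\<in>?F \<pi>. \<Sum>\<sigma>\<in>?M. ?ind \<sigma> \<pi>) = (\<Sum>(\<pi>, f)\<in>?C. \<Sum>\<sigma>\<in>?M. ?ind \<sigma> \<pi>)"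
    unfolding C using fin(2) finF by (subst sum.Sigma) auto
  also have "\<dots> = (\<Sum>(\<pi>, f)\<in>?C. \<Sum>\<sigma>\<in>?M. \<Sum>I | I \<subseteq> S - {e}.
      if \<sigma> ` \<pi> ` I = I then (-1) ^ card I * sign_on I (\<sigma> \<circ> \<pi>) else 0)"
  proof (intro sum.cong refl, clarify)
    fix \<pi> f assume "(\<pi>, f) \<in> ?C"
    then have p: "\<pi> permutes S" by (simp add: coloured_perms_def)
    show "(\<Sum>\<sigma>\<in>?M. ?ind \<sigma> \<pi>) = (\<Sum>\<sigma>\<in>?M. \<Sum>I | I \<subseteq> S - {e}.
      if \<sigma> ` \<pi> ` I = I then (-1) ^ card I * sign_on I (\<sigma> \<circ> \<pi>) else 0)"
    proof (rule sum.cong[OF refl])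
      fix \<sigma> assume s: "\<sigma> \<in> ?M"
      have "{I. I \<subseteq> S - {e} \<and> (\<sigma> \<circ> \<pi>) ` I = I} = {I \<in> {I. I \<subseteq> S - {e}}. \<sigma> ` \<pi> ` I = I}"
        by (simp add: image_comp)
      then have "?ind \<sigma> \<pi> = (\<Sum>I | I \<in> {I. I \<subseteq> S - {e}} \<and> \<sigma> ` \<pi> ` I = I. (-1) ^ card I * sign_on I (\<sigma> \<circ> \<pi>))"
        using cyclic_indicator[OF S(1) sp[OF s p] e] by simp
      also have "\<dots> = (\<Sum>I | I \<subseteq> S - {e}. if \<sigma> ` \<pi> ` I = I then (-1) ^ card I * sign_on I (\<sigma> \<circ> \<pi>) else 0)"
        by (rule sum.inter_filter) (use S(1) in auto)
      finally show "?ind \<sigma> \<pi> = (\<Sum>I | I \<subseteq> S - {e}. if \<sigma> ` \<pi> ` I = I then (-1) ^ card I * sign_on I (\<sigma> \<circ> \<pi>) else 0)" .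
    qed
  qed
  also have "\<dots> = (\<Sum>(\<pi>, f)\<in>?C. \<Sum>I | I \<subseteq> S - {e}. (-1) ^ card I * signed_count S I \<pi>)"
  proof (intro sum.cong refl, clarify)
    fix \<pi> f
    have "(\<Sum>\<sigma>\<in>?M. if \<sigma> ` \<pi> ` I = I then (-1) ^ card I * sign_on I (\<sigma> \<circ> \<pi>) else 0)
        = (-1) ^ card I * signed_count S I \<pi>" for I
      unfolding signed_count_def sum_distrib_left by (rule sum.inter_filter[OF fin(1), symmetric])
    then show "(\<Sum>\<sigma>\<in>?M. \<Sum>I | I \<subseteq> S - {e}.
      if \<sigma> ` \<pi> ` I = I then (-1) ^ card I * sign_on I (\<sigma> \<circ> \<pi>) else 0)
      = (\<Sum>I | I \<subseteq> S - {e}. (-1) ^ card I * signed_count S I \<pi>)"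
      by (subst sum.swap) simp
  qed
  also have "\<dots> = (\<Sum>I | I \<subseteq> S - {e}. (-1) ^ card I * (\<Sum>(\<pi>, f)\<in>?C. signed_count S I \<pi>))"
    unfolding case_prod_beta sum_distrib_left by (rule sum.swap)
  also have "real_of_int \<dots> = (\<Sum>I | I \<subseteq> S - {e}. (-1) ^ card I * signed_total (2 * n) q (card I))"
  proof -
    have V: "real_of_int (\<Sum>(\<pi>, f)\<in>?C. signed_count S I \<pi>) = signed_total (2 * n) q (card I)"
      if "I \<subseteq> S - {e}" for I
      using signed_total_eq[OF S Q(1), of I] that e Q(2) by auto
    show ?thesis
      unfolding of_int_sum[of _ "{I. I \<subseteq> S - {e}}"] of_int_mult
      by (intro sum.cong refl arg_cong2[where f = "(*)"] V) auto
  qed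
  also have "\<dots> = (\<Sum>k\<le>2 * n - 1. real ((2 * n - 1) choose k) * ((-1) ^ k * signed_total (2 * n) q k))"
    using sum_Pow_card[of "S - {e}" "\<lambda>k. (-1) ^ k * signed_total (2 * n) q k"] S e by simp
  also note sum_signed_total[OF n]
  finally show ?thesis .
qed

section \<open>Comparison of coefficients in the number of colours\<close>

lemma coeff_eqI_nat:
  fixes c d :: "nat \<Rightarrow> real"
  assumes "\<And>q :: nat. (\<Sum>m\<le>M. c m * real q ^ m) = (\<Sum>m\<le>M. d m * real q ^ m)" "m \<le> M"
  shows "c m = d m"
proof (rule ccontr)
  assume "c m \<noteq> d m"
  then have "\<exists>i\<le>M. c i - d i \<noteq> 0" using assms(2) by auto
  then have "finite {x. (\<Sum>i\<le>M. (c i - d i) * x ^ i) = 0}" by (simp only: polyfun_finite_roots)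
  moreover have "range real \<subseteq> {x. (\<Sum>i\<le>M. (c i - d i) * x ^ i) = 0}"
    using assms(1) by (auto simp: left_diff_distrib sum_subtractf)
  ultimately have "finite (range real)" by (rule finite_subset[rotated])
  then show False using finite_imageD[of real UNIV] inj_of_nat by auto
qed

text \<open>The falling factorial of q is, up to sign, the rising factorial of -q, whose
  coefficients are the unsigned Stirling numbers. Padding with zeros up to M gives all j a common
  range of summation.\<close>

lemma binomial_stirling:
  assumes "j \<le> M"
  shows "real (q choose j) = (\<Sum>m\<le>M. (-1) ^ (j + m) * real (stirling j m) / fact j * real q ^ m)"
proof -
  have "real (q choose j) = (-1) ^ j * pochhammer (- real q) j / fact j"
    by (simp add: binomial_gbinomial gbinomial_pochhammer)
  also have "\<dots> = (\<Sum>m\<le>j. (-1) ^ (j + m) * real (stirling j m) / fact j * real q ^ m)"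
    unfolding stirling_pochhammer[symmetric] sum_distrib_left sum_divide_distrib
    by (intro sum.cong refl) (simp add: power_add power_minus[of "real q"])
  also have "\<dots> = (\<Sum>m\<le>M. (-1) ^ (j + m) * real (stirling j m) / fact j * real q ^ m)"
    by (rule sum.mono_neutral_left) (use assms in auto)
  finally show ?thesis .
qed

text \<open>Indexed by the number of cycles instead of the genus, so that the counts for all m are
  the coefficients of a single polynomial in q.\<close>

definition one_face_count :: "nat \<Rightarrow> nat \<Rightarrow> nat" where
  "one_face_count n m = card {(\<sigma>, \<pi>). \<sigma> \<in> matchings {1..2 * n} \<and> \<pi> permutes {1..2 * n} \<and>
     \<sigma> \<circ> \<pi> = long_cycle (2 * n) \<and> num_cycles \<pi> {1..2 * n} = m}"

text \<open>This is the Harer-Zagier formula. The factor (2n-1)! brought in by conjugation occurs on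
  both sides and cancels.\<close>

lemma sum_one_face_count:
  assumes n: "n \<ge> 1"
  shows "(\<Sum>m\<le>2 * n. real (one_face_count n m) * real q ^ m) = real (dfact (2 * n - 1)) *
       (\<Sum>k\<le>n. 2 ^ k * real (n choose k) * real (q choose Suc k))"
proof -
  let ?S = "{1..2 * n}"
  let ?Y = "{(\<sigma>, \<pi>). \<sigma> \<in> matchings ?S \<and> \<pi> permutes ?S \<and> orbit (\<sigma> \<circ> \<pi>) 1 = ?S}"
  have fin: "finite ?Y"
    by (rule finite_subset[of _ "matchings ?S \<times> {\<pi>. \<pi> permutes ?S}"])
      (auto simp: finite_permutations finite_matchings)
  have "(\<Sum>(\<sigma>, \<pi>)\<in>?Y. real q ^ num_cycles \<pi> ?S)
      = (\<Sum>m\<le>2 * n. \<Sum>y | y \<in> ?Y \<and> num_cycles (snd y) ?S = m. case y of (\<sigma>, \<pi>) \<Rightarrow> real q ^ num_cycles \<pi> ?S)"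
  proof (rule sum.group[symmetric])
    show "(\<lambda>y. num_cycles (snd y) ?S) ` ?Y \<subseteq> {..2 * n}"
      using card_image_le[of ?S] by (fastforce simp: num_cycles_def)
  qed (use fin in auto)
  also have "\<dots> = (\<Sum>m\<le>2 * n. fact (2 * n - 1) * (real (one_face_count n m) * real q ^ m))"
  proof (rule sum.cong[OF refl])
    fix m
    have eq: "{y \<in> ?Y. num_cycles (snd y) ?S = m} = {(\<sigma>, \<pi>). \<sigma> \<in> matchings ?S \<and> \<pi> permutes ?S \<and>
            orbit (\<sigma> \<circ> \<pi>) 1 = ?S \<and> num_cycles \<pi> ?S = m}" by auto
    have "(\<Sum>y | y \<in> ?Y \<and> num_cycles (snd y) ?S = m. case y of (\<sigma>, \<pi>) \<Rightarrow> real q ^ num_cycles \<pi> ?S)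
        = (\<Sum>y | y \<in> ?Y \<and> num_cycles (snd y) ?S = m. real q ^ m)"
      by (rule sum.cong) auto
    also have "\<dots> = fact (2 * n - 1) * (real (one_face_count n m) * real q ^ m)"
      unfolding sum_constant eq using card_full_cycle_pairs[of "2 * n" m] n
      by (simp add: one_face_count_def)
    finally show "(\<Sum>y | y \<in> ?Y \<and> num_cycles (snd y) ?S = m. case y of (\<sigma>, \<pi>) \<Rightarrow> real q ^ num_cycles \<pi> ?S)
        = fact (2 * n - 1) * (real (one_face_count n m) * real q ^ m)" .
  qed
  also have "\<dots> = fact (2 * n - 1) * (\<Sum>m\<le>2 * n. real (one_face_count n m) * real q ^ m)"
    by (simp only: sum_distrib_left)
  finally have "fact (2 * n - 1) * (\<Sum>m\<le>2 * n. real (one_face_count n m) * real q ^ m) =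
      fact (2 * n - 1) * (real (dfact (2 * n - 1)) * (\<Sum>k\<le>n. 2 ^ k * real (n choose k) * real (q choose Suc k)))"
    using sum_full_cycle_pairs[of ?S n 1 q] n by (simp add: mult.assoc)
  then show ?thesis by simp
qed

lemma one_face_count_eq:
  assumes n: "n \<ge> 1" and m: "m \<le> 2 * n"
  shows "real (one_face_count n m) = real (dfact (2 * n - 1)) *
     (\<Sum>k\<le>n. 2 ^ k * real (n choose k) * ((-1) ^ (Suc k + m) * real (stirling (Suc k) m) / fact (Suc k)))"
proof (rule coeff_eqI_nat[OF _ m])
  fix q
  have "(\<Sum>m\<le>2 * n. real (dfact (2 * n - 1)) * (\<Sum>k\<le>n. 2 ^ k * real (n choose k) *
           ((-1) ^ (Suc k + m) * real (stirling (Suc k) m) / fact (Suc k))) * real q ^ m)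
      = real (dfact (2 * n - 1)) * (\<Sum>k\<le>n. 2 ^ k * real (n choose k) *
          (\<Sum>m\<le>2 * n. (-1) ^ (Suc k + m) * real (stirling (Suc k) m) / fact (Suc k) * real q ^ m))"
    unfolding sum_distrib_left sum_distrib_right
    by (subst sum.swap) (simp only: mult_ac times_divide_eq_right times_divide_eq_left)
  also have "\<dots> = real (dfact (2 * n - 1)) * (\<Sum>k\<le>n. 2 ^ k * real (n choose k) * real (q choose Suc k))"
    using n by (intro arg_cong2[where f = "(*)"] sum.cong refl binomial_stirling[symmetric]) auto
  finally show "(\<Sum>m\<le>2 * n. real (one_face_count n m) * real q ^ m) =
      (\<Sum>m\<le>2 * n. real (dfact (2 * n - 1)) * (\<Sum>k\<le>n. 2 ^ k * real (n choose k) *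
           ((-1) ^ (Suc k + m) * real (stirling (Suc k) m) / fact (Suc k))) * real q ^ m)"
    unfolding sum_one_face_count[OF n] by (rule sym)
qed

lemma xi_eq_one_face_count: "xi n g = one_face_count n (n + 1 - 2 * g)"
  unfolding xi_def one_face_count_def matchings_def
  by (intro arg_cong[of _ _ card]) auto

lemma xi_formula:
  assumes n: "n \<ge> 1" and g: "2 * g \<le> n"
  shows "real (xi n g) = real (dfact (2*n - 1)) *
           (\<Sum>k\<le>n. (-1) ^ k * real (stirling (n + 1 - 2*g + k) (n + 1 - 2*g))
              / fact (n + 1 - 2*g + k)
              * real (n choose (n + 1 - 2*g + k - 1)) * 2 ^ (n + 1 - 2*g + k - 1))"
proof -
  define r where "r = n - 2 * g"
  have r: "n + 1 - 2 * g = Suc r" "r \<le> n" using g by (auto simp: r_def)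
  \<comment> \<open>With m = r + 1, the Stirling number kills h k for k < r and the binomial kills
    it for k > n. The range may thus be replaced by r, ..., r + n, and after the shift by r the sign
    has the parity of the new index.\<close>
  define h where "h k = 2 ^ k * real (n choose k) * ((-1) ^ (Suc k + Suc r) * real (stirling (Suc k) (Suc r)) / fact (Suc k))" for k
  have "(\<Sum>k\<le>n. h k) = (\<Sum>k\<in>{r..r + n}. h k)"
  proof -
    have "(\<Sum>k\<le>n. h k) = (\<Sum>k\<in>{r..n}. h k)"
      by (rule sum.mono_neutral_right) (auto simp: h_def)
    also have "\<dots> = (\<Sum>k\<in>{r..r + n}. h k)"
      by (rule sum.mono_neutral_left) (auto simp: h_def)
    finally show ?thesis .
  qed
  also have "\<dots> = (\<Sum>k\<le>n. h (r + k))"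
    using sum.shift_bounds_cl_nat_ivl[of h 0 r n] by (simp add: atLeast0AtMost add.commute)
  also have "\<dots> = (\<Sum>k\<le>n. (-1) ^ k * real (stirling (Suc r + k) (Suc r)) / fact (Suc r + k)
              * real (n choose (Suc r + k - 1)) * 2 ^ (Suc r + k - 1))"
    by (intro sum.cong refl) (simp add: h_def power_add mult_ac del: stirling.simps)
  finally show ?thesis
    using one_face_count_eq[OF n, of "Suc r"] r(2) n
    unfolding xi_eq_one_face_count r(1) h_def[abs_def] by (simp del: stirling.simps fact_Suc)
qed

theorem theorem4p13:
  fixes n g :: nat
  assumes "n \<ge> 1" and "2 * g \<le> n"
  shows "real (xi n g) = real (dfact (2*n - 1)) *
           (\<Sum>k\<le>n. (-1) ^ k * real (stirling (n + 1 - 2*g + k) (n + 1 - 2*g))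
              / fact (n + 1 - 2*g + k)
              * real (n choose (n + 1 - 2*g + k - 1)) * 2 ^ (n + 1 - 2*g + k - 1))
       \<and> real (xi n 0) = real ((2*n) choose n) / real (n + 1)"
proof
  let ?t = "\<lambda>k. (-1) ^ k * real (stirling (n + 1 + k) (n + 1)) / fact (n + 1 + k)
              * real (n choose (n + 1 + k - 1)) * 2 ^ (n + 1 + k - 1)"
  have "real (xi n 0) = real (dfact (2 * n - 1)) * (\<Sum>k\<le>n. ?t k)"
    using xi_formula[OF assms(1), of 0] by simp
  \<comment> \<open>In genus 0 the lower index of the binomial is n + k, so only k = 0
    survives.\<close>
  also have "(\<Sum>k\<le>n. ?t k) = (\<Sum>k\<in>{0}. ?t k)"
    by (rule sum.mono_neutral_right) auto
  also have "\<dots> = 2 ^ n / fact (n + 1)" by simp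
  also have "real (dfact (2 * n - 1)) * (2 ^ n / fact (n + 1)) = fact (2 * n) / (fact n * fact n) / real (n + 1)"
    unfolding fact_double by (simp add: field_simps)
  also have "fact (2 * n) / (fact n * fact n) = real ((2 * n) choose n)"
    by (subst binomial_fact) auto
  finally show "real (xi n 0) = real ((2*n) choose n) / real (n + 1)" .
qed (rule xi_formula[OF assms])

end
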